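(* Let $\kappa$ be an infinite cardinal, let $I,I'$ be sets, and let $D\subseteq\mathcal P(I)$ and $D'\subseteq\mathcal P(I')$. If $\kappa$ is singular, $D'$ is $\operatorname{cf}\kappa$-decomposable, and $D$ is $\kappa^+$-decomposable, then $D\times D'$ is $\kappa$-decomposable.
   Context: Notation: for a set $S$ and a cardinal $\nu$, $[S]^{<\nu}=\{Z\subseteq S : |Z|<\nu\}$; $\mathcal P(I)$ is the set of all subsets of $I$; $\operatorname{cf}\kappa$ is the cofinality of $\kappa$ and $\kappa^+$ its successor cardinal. The families $D,D'$ are arbitrary families of subsets; they are not assumed to be filters or ultrafilters. For an infinite cardinal $\nu$, a family $E\subseteq\mathcal P(J)$ is $\nu$-decomposable if there is a function $f:J\to\nu$ such that $f^{-1}(Z)\notin E$ whenever $Z\in[\nu]^{<\nu}$. The product $D\times D'\subseteq\mathcal P(I\times I')$ is defined by: $X\in D\times D'$ if and only if $\{i\in I : \{i'\in I' : (i,i')\in X\}\in D'\}\in D$. *)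

theory Defs
  imports Main
begin

unbundle cardinal_syntax

(* For an infinite cardinal k, the least cardinality of a cofinal subset of k.  The library's
   cofinal asks for strictly larger elements, which is the usual notion because an infinite
   cardinal is a limit ordinal.  The value is represented as a cardinal on the type of k. *)
definition cf :: "'k rel \<Rightarrow> 'k rel" where
  "cf k = |SOME K. K \<subseteq> Field k \<and> cofinal K k \<and>
                   (\<forall>L. L \<subseteq> Field k \<and> cofinal L k \<longrightarrow> |K| \<le>o |L| )|"

lemma cf_witness:
  assumes "Cinfinite k"
  obtains K where "K \<subseteq> Field k" and "cofinal K k" and "cf k = |K|"
    and "\<And>L. L \<subseteq> Field k \<Longrightarrow> cofinal L k \<Longrightarrow> |K| \<le>o |L|"
proof -
  let ?C = "{|K| | K. K \<subseteq> Field k \<and> cofinal K k}"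
  have "cofinal (Field k) k"
    using infinite_Card_order_limit[of k] assms
    unfolding cofinal_def cinfinite_def by blast
  then have "?C \<noteq> {}" by blast
  moreover have "\<forall>r\<in>?C. Well_order r" using card_of_Well_order by blast
  ultimately obtain r where "r \<in> ?C" "\<forall>r'\<in>?C. r \<le>o r'"
    using exists_minim_Well_order[of ?C] by blast
  then have "\<exists>K. K \<subseteq> Field k \<and> cofinal K k \<and>
      (\<forall>L. L \<subseteq> Field k \<and> cofinal L k \<longrightarrow> |K| \<le>o |L| )" by blast
  from someI_ex[OF this] show thesis
    using that unfolding cf_def by blast
qed

lemma regularCard_iff_cf:
  assumes "Cinfinite k"
  shows "regularCard k \<longleftrightarrow> cf k =o k"
proof -
  obtain K where K: "K \<subseteq> Field k" "cofinal K k" "cf k = |K|"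
    and le: "\<And>L. L \<subseteq> Field k \<Longrightarrow> cofinal L k \<Longrightarrow> |K| \<le>o |L|"
    using cf_witness[OF assms] by metis
  have "|L| =o k" if "cf k =o k" "L \<subseteq> Field k" "cofinal L k" for L
  proof -
    have "k \<le>o |L|"
      using that K(3) le ordIso_ordLeq_trans ordIso_symmetric by metis
    moreover have "|L| \<le>o k"
      using that(2) assms card_of_mono1 card_of_Field_ordIso ordLeq_ordIso_trans by metis
    ultimately show ?thesis using ordIso_iff_ordLeq by blast
  qed
  then show ?thesis using K unfolding regularCard_def by metis
qed

lemma not_regularCard_iff_cf:
  assumes "Cinfinite k"
  shows "\<not> regularCard k \<longleftrightarrow> cf k <o k"
proof -
  obtain K where K: "K \<subseteq> Field k" "cf k = |K|"
    using cf_witness[OF assms] by metis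
  then have "cf k \<le>o k"
    using assms card_of_mono1 card_of_Field_ordIso ordLeq_ordIso_trans by metis
  then show ?thesis
    using regularCard_iff_cf[OF assms] ordLeq_iff_ordLess_or_ordIso not_ordLess_ordIso by blast
qed

definition decomposable :: "'n rel \<Rightarrow> 'j set \<Rightarrow> 'j set set \<Rightarrow> bool" where
  "decomposable \<nu> J E \<longleftrightarrow>
     (\<exists>f. f ` J \<subseteq> Field \<nu> \<and>
          (\<forall>Z. Z \<subseteq> Field \<nu> \<and> |Z| <o \<nu> \<longrightarrow> f -` Z \<inter> J \<notin> E))"

definition family_prod ::
    "'i set \<Rightarrow> 'i set set \<Rightarrow> 'j set \<Rightarrow> 'j set set \<Rightarrow> ('i \<times> 'j) set set" where
  "family_prod I D I' D' =
     {X. X \<subseteq> I \<times> I' \<and> {i \<in> I. {i' \<in> I'. (i, i') \<in> X} \<in> D'} \<in> D}"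

end

theory Submission
  imports Defs
begin

text \<open>
  Write \<open>\<lambda> = cf \<kappa>\<close>.  Composing the decompositions \<open>I \<rightarrow> \<kappa>\<^sup>+\<close> and \<open>I' \<rightarrow> \<lambda>\<close> with a map
  \<open>\<phi> : \<kappa>\<^sup>+ \<times> \<lambda> \<rightarrow> \<kappa>\<close> gives a map \<open>I \<times> I' \<rightarrow> \<kappa>\<close>, and it decomposes the product as soon as
  \<open>\<phi>\<close> has the following property: for each \<open>Z\<close> with \<open>|Z| < \<kappa>\<close>, at most \<open>\<kappa>\<close> many \<open>\<alpha>\<close> have
  \<open>\<phi> \<alpha> \<beta> \<in> Z\<close> for \<open>\<lambda>\<close> many \<open>\<beta>\<close> (lemma \<open>sparse_functions\<close>).  All the work is in finding such a \<open>\<phi>\<close>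
  without any assumption on cardinal arithmetic; this is a piece of Shelah's pcf theory.

  Choose an increasing chain of sets \<open>B \<beta>\<close>, \<open>\<beta> < \<lambda>\<close>, of size below \<open>\<kappa>\<close> that covers \<open>\<kappa>\<close>.
  Consider functions \<open>f \<alpha>\<close>, \<open>\<alpha> < \<kappa>\<^sup>+\<close>, on \<open>\<lambda>\<close>, where \<open>f \<alpha>\<close> takes its value at \<open>\<beta>\<close> in the
  regular cardinal \<open>|B \<beta>|\<^sup>+\<close>.
  One arranges recursively that the sequence increases
  modulo bounded subsets of \<open>\<lambda>\<close> and that each \<open>f \<delta>\<close> is, from some \<open>\<nu>\<close> on, above all members
  with index in some club of \<open>\<delta>\<close>, with one \<open>\<nu>\<close> for the whole club, provided that \<open>\<delta>\<close> has a
  club of size below \<open>\<kappa>\<close> (\<open>club_dominating_sequence\<close>). An injective code in \<open>\<kappa>\<close> of the pairs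
  of a coordinate \<open>\<beta>\<close> and the value of \<open>f \<alpha>\<close> there is the required \<open>\<phi> \<alpha> \<beta>\<close>.

  Suppose now that \<open>T\<close> is unbounded in \<open>\<kappa>\<^sup>+\<close> and that for each \<open>\<alpha> \<in> T\<close> there are unboundedly
  many \<open>\<beta>\<close> with \<open>\<phi> \<alpha> \<beta> \<in> Z\<close>. Let \<open>\<theta>\<close> be the successor of \<open>|Z \<union> \<lambda>|\<close> and \<open>\<mu> = \<theta>\<^sup>+\<^sup>+\<close>, which is
  still below \<open>\<kappa>\<close>. By club guessing (\<open>club_guessing\<close>) there are \<open>\<mu>\<close> many sets \<open>C i\<close> such
  that every club of \<open>\<mu>\<close> includes one of them of size at least \<open>\<theta>\<close>. Build \<open>t j \<in> T\<close>,
  \<open>j < \<mu>\<close>, increasing, with suprema \<open>stage j\<close> of the earlier entries, such that for each \<open>i\<close>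
  the function \<open>f (t j)\<close> dominates the set \<open>{f (stage k) | k \<in> C i, k \<le> j}\<close> uniformly
  whenever any function of the sequence does. The limit \<open>\<delta>\<close> of the construction has
  cofinality \<open>\<mu>\<close>, so \<open>f \<delta>\<close> dominates the functions over a club of \<open>\<delta>\<close>, and this club
  contains \<open>stage j\<close> for a club of \<open>j\<close>. Some \<open>C i\<close> guesses the latter, and for that \<open>i\<close> the
  proviso holds at every stage. So the functions \<open>f (t j)\<close>, \<open>j \<in> C i\<close>, are pairwise
  different at every coordinate beyond two bounds \<open>\<nu> j\<close>, \<open>\<nu> k\<close> that depend on the single
  indices (\<open>disjoint_tails\<close>). Picking for each \<open>j \<in> C i\<close> a coordinate \<open>\<beta>\<close> beyond \<open>\<nu> j\<close> with
  \<open>\<phi> (t j) \<beta> \<in> Z\<close> therefore injects a set of size at least \<open>\<theta>\<close> into \<open>Z\<close>, which is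
  impossible.
\<close>

section \<open>Strict orders and closed unbounded sets in a well-order\<close>

abbreviation below :: "'a \<Rightarrow> 'a rel \<Rightarrow> 'a \<Rightarrow> bool"  ("(_ \<prec>\<^bsub>_\<^esub> _)" [51, 0, 51] 50)
  where "x \<prec>\<^bsub>r\<^esub> y \<equiv> x \<in> underS r y"

abbreviation ssup :: "'a rel \<Rightarrow> 'a set \<Rightarrow> 'a"
  where "ssup \<equiv> wo_rel.suc"

text \<open>
  The bound ranges over a set \<open>A\<close>, which below is the field of \<open>r\<close> or a proper initial segment, so that
  directedness of ordinals below a limit can be expressed.
\<close>

definition bdd :: "'a rel \<Rightarrow> 'a set \<Rightarrow> 'a set \<Rightarrow> bool"
  where "bdd r A X \<longleftrightarrow> (\<exists>b\<in>A. \<forall>x\<in>X. x \<prec>\<^bsub>r\<^esub> b)"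

text \<open>
  Closure is asked at every point of \<open>A\<close> that is a limit of \<open>E\<close> from below; the least element of \<open>A\<close>
  qualifies vacuously and so belongs to every club.
\<close>

definition club :: "'a rel \<Rightarrow> 'a set \<Rightarrow> 'a set \<Rightarrow> bool"
  where "club r A E \<longleftrightarrow>
    E \<subseteq> A \<and> (\<forall>x\<in>A. \<exists>e\<in>E. x \<prec>\<^bsub>r\<^esub> e) \<and>
    (\<forall>x\<in>A. (\<forall>y. y \<prec>\<^bsub>r\<^esub> x \<longrightarrow> (\<exists>e\<in>E. y \<prec>\<^bsub>r\<^esub> e \<and> e \<prec>\<^bsub>r\<^esub> x)) \<longrightarrow> x \<in> E)"

lemma below_Field: "x \<prec>\<^bsub>r\<^esub> y \<Longrightarrow> x \<in> Field r" "x \<prec>\<^bsub>r\<^esub> y \<Longrightarrow> y \<in> Field r"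
  by (auto simp: underS_def Field_def)

lemma below_irrefl: "\<not> x \<prec>\<^bsub>r\<^esub> x"
  by (auto simp: underS_def)

lemma below_trans:
  assumes "Well_order r" "x \<prec>\<^bsub>r\<^esub> y" "y \<prec>\<^bsub>r\<^esub> z"
  shows "x \<prec>\<^bsub>r\<^esub> z"
proof -
  have "trans r" "antisym r"
    using assms(1) by (auto simp: order_on_defs)
  then show ?thesis
    using assms(2,3) unfolding underS_def trans_def antisym_def by blast
qed

lemma below_linear:
  assumes "Well_order r" "x \<in> Field r" "y \<in> Field r"
  shows "x \<prec>\<^bsub>r\<^esub> y \<or> x = y \<or> y \<prec>\<^bsub>r\<^esub> x"
  using assms unfolding order_on_defs total_on_def underS_def by blast

lemma wf_below:
  assumes "Well_order r"
  shows "wf {(x, y). x \<prec>\<^bsub>r\<^esub> y}"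
proof -
  have "{(x, y). x \<prec>\<^bsub>r\<^esub> y} = r - Id"
    by (auto simp: underS_def)
  then show ?thesis
    using assms by (simp add: well_order_on_def)
qed

lemma not_below_iff:
  assumes "Well_order r" "x \<in> Field r" "y \<in> Field r"
  shows "\<not> x \<prec>\<^bsub>r\<^esub> y \<longleftrightarrow> y = x \<or> y \<prec>\<^bsub>r\<^esub> x"
  using below_linear[OF assms] below_irrefl below_trans[OF assms(1)] by metis

text \<open>
  Since orders are taken relative to a field, \<open>x \<le> y\<close> is written \<open>\<not> y < x\<close> throughout.
\<close>

lemma below_trans2:
  assumes "Well_order r" "\<not> y \<prec>\<^bsub>r\<^esub> x" "y \<prec>\<^bsub>r\<^esub> z" "x \<in> Field r"
  shows "x \<prec>\<^bsub>r\<^esub> z"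
  using assms below_linear[OF assms(1), of x y] below_Field[of y r z] below_trans[OF assms(1)]
  by metis

lemma ssup_upper:
  assumes "Well_order r" "bdd r (Field r) X"
  shows "x \<in> X \<Longrightarrow> x \<prec>\<^bsub>r\<^esub> ssup r X" "ssup r X \<in> Field r"
proof -
  interpret w: wo_rel r by (simp add: wo_rel_def assms(1))
  have X: "X \<subseteq> Field r" and ne: "AboveS r X \<noteq> {}"
    using assms(2) below_Field(1) unfolding bdd_def AboveS_def underS_def by (fast, fast)
  show "x \<in> X \<Longrightarrow> x \<prec>\<^bsub>r\<^esub> ssup r X"
    using w.suc_greater[OF X ne] by (auto simp: underS_def)
  show "ssup r X \<in> Field r"
    using w.suc_inField[OF X ne] .
qed

lemma ssup_least:
  assumes "Well_order r" "y \<in> Field r" "\<And>x. x \<in> X \<Longrightarrow> x \<prec>\<^bsub>r\<^esub> y"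
  shows "\<not> y \<prec>\<^bsub>r\<^esub> ssup r X"
proof -
  interpret w: wo_rel r by (simp add: wo_rel_def assms(1))
  have "y \<in> AboveS r X"
    using assms(2,3) by (auto simp: AboveS_def underS_def)
  then have "(ssup r X, y) \<in> r"
    by (rule w.suc_least_AboveS)
  then show ?thesis
    using w.ANTISYM unfolding underS_def antisym_def by blast
qed

lemma below_ssupD:
  assumes "Well_order r" "y \<prec>\<^bsub>r\<^esub> ssup r X"
  obtains x where "x \<in> X" "\<not> x \<prec>\<^bsub>r\<^esub> y"
  using ssup_least[OF assms(1) below_Field(1)[OF assms(2)], of X] assms(2) by blast

lemma bdd_regular:
  assumes "Cinfinite r" "regularCard r" "X \<subseteq> Field r" "|X| <o r"
  shows "bdd r (Field r) X"
proof -
  have wo: "Well_order r"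
    using assms(1) by (auto simp: card_order_on_def)
  have "\<not> cofinal X r"
    using assms(2-4) not_ordLess_ordIso unfolding regularCard_def by blast
  then obtain a where a: "a \<in> Field r" "\<forall>b\<in>X. \<not> a \<prec>\<^bsub>r\<^esub> b"
    unfolding cofinal_def underS_def by blast
  obtain b where b: "b \<in> Field r" "a \<prec>\<^bsub>r\<^esub> b"
    using infinite_Card_order_limit[of r a] assms(1) a(1)
    unfolding cinfinite_def underS_def by blast
  have "x \<prec>\<^bsub>r\<^esub> b" if "x \<in> X" for x
    using below_trans2[OF wo, of a x b] a b that assms(3) by blast
  then show ?thesis
    unfolding bdd_def using b(1) by blast
qed

lemma no_max:
  assumes "Cinfinite r" "a \<in> Field r"
  obtains b where "a \<prec>\<^bsub>r\<^esub> b"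
  using infinite_Card_order_limit[of r a] assms unfolding cinfinite_def underS_def by blast

lemma ofilter_below: "ofilter r A \<Longrightarrow> x \<in> A \<Longrightarrow> y \<prec>\<^bsub>r\<^esub> x \<Longrightarrow> y \<in> A"
  unfolding ofilter_def under_def underS_def by blast

lemma ofilter_Field: "ofilter r (Field r)"
  unfolding ofilter_def under_def Field_def by blast

lemma ofilter_underS: "Well_order r \<Longrightarrow> ofilter r (underS r a)"
  using wo_rel.underS_ofilter[of r a] by (simp add: wo_rel_def)

lemma card_insert_image:
  assumes "natLeq \<le>o \<rho>" "|N| \<le>o \<rho>"
  shows "|insert y (g ` N)| \<le>o \<rho>"
proof -
  have c: "|g ` N| \<le>o \<rho>"
    using card_of_image ordLeq_transitive assms(2) by blast
  show ?thesis
  proof (cases "finite (g ` N)")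
    case True
    then have "|insert y (g ` N)| \<le>o natLeq"
      using finite_iff_ordLess_natLeq ordLess_imp_ordLeq by blast
    then show ?thesis
      using assms(1) ordLeq_transitive by blast
  next
    case False
    have "g ` N \<noteq> {}"
      using False by auto
    then have "|{y}| \<le>o |g ` N|"
      by (rule card_of_singl_ordLeq)
    then have "|{y} \<union> g ` N| \<le>o |g ` N|"
      using card_of_Un_ordLeq_infinite_Field[of "|g ` N|" "{y}" "g ` N"] False
      by (simp add: card_of_mono1 card_of_card_order_on Field_card_of)
    then show ?thesis
      using ordLeq_transitive[OF _ c] by simp
  qed
qed

text \<open>
  Starting above \<open>x\<close>, pass \<open>\<omega>\<close> times to a point beyond a next member of every \<open>F n\<close>.  The supremum of
  these points is a limit of each \<open>F n\<close>.  Directedness of \<open>A\<close> for sets of size \<open>\<rho>\<close> is used twice: to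
  bound the next members, and to bound the \<open>\<omega>\<close> points.
\<close>

lemma club_Inter:
  assumes wo: "Well_order r" and of: "ofilter r A"
    and dir: "\<And>X. X \<subseteq> A \<Longrightarrow> |X| \<le>o \<rho> \<Longrightarrow> bdd r A X"
    and inf: "natLeq \<le>o \<rho>" and N: "|N| \<le>o \<rho>"
    and F: "\<And>n. n \<in> N \<Longrightarrow> club r A (F n)"
  shows "club r A (A \<inter> (\<Inter>n\<in>N. F n))"
proof -
  have step: "\<exists>z\<in>A. y \<prec>\<^bsub>r\<^esub> z \<and> (\<forall>n\<in>N. \<exists>e\<in>F n. y \<prec>\<^bsub>r\<^esub> e \<and> e \<prec>\<^bsub>r\<^esub> z)" if y: "y \<in> A" for y
  proof -
    have "\<forall>n\<in>N. \<exists>e\<in>F n. y \<prec>\<^bsub>r\<^esub> e"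
      using F y unfolding club_def by blast
    then obtain g where g: "\<And>n. n \<in> N \<Longrightarrow> g n \<in> F n \<and> y \<prec>\<^bsub>r\<^esub> g n"
      by metis
    have "insert y (g ` N) \<subseteq> A"
      using y g F unfolding club_def by blast
    then have "bdd r A (insert y (g ` N))"
      using dir card_insert_image[OF inf N, of y g] by (intro dir)
    then show ?thesis
      unfolding bdd_def using g by blast
  qed
  then obtain nx where nx: "\<And>y. y \<in> A \<Longrightarrow> nx y \<in> A \<and> y \<prec>\<^bsub>r\<^esub> nx y \<and>
      (\<forall>n\<in>N. \<exists>e\<in>F n. y \<prec>\<^bsub>r\<^esub> e \<and> e \<prec>\<^bsub>r\<^esub> nx y)"
    by metis
  have unb: "\<exists>e\<in>A \<inter> (\<Inter>n\<in>N. F n). x \<prec>\<^bsub>r\<^esub> e" if x: "x \<in> A" for x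
  proof -
    define s where "s k = (nx ^^ k) x" for k
    have sA: "s k \<in> A" for k
      by (induction k) (auto simp: s_def x nx)
    have s_Suc: "s (Suc k) = nx (s k)" for k
      by (simp add: s_def)
    have "|range s| \<le>o |UNIV :: nat set|"
      by (rule card_of_image)
    then have "|range s| \<le>o \<rho>"
      using inf card_of_nat ordLeq_ordIso_trans ordLeq_transitive by blast
    then obtain b where b: "b \<in> A" "\<And>k. s k \<prec>\<^bsub>r\<^esub> b"
      using dir[of "range s"] sA unfolding bdd_def by blast
    have AF: "A \<subseteq> Field r"
      using of unfolding ofilter_def by blast
    define z where "z = ssup r (range s)"
    have bd: "bdd r (Field r) (range s)"
      using b AF unfolding bdd_def by blast
    have sz: "s k \<prec>\<^bsub>r\<^esub> z" for k
      unfolding z_def using ssup_upper(1)[OF wo bd] by blast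
    have "\<not> b \<prec>\<^bsub>r\<^esub> z"
      unfolding z_def by (rule ssup_least[OF wo]) (use b AF in auto)
    then have zA: "z \<in> A"
      using not_below_iff[OF wo, of b z] b AF ssup_upper(2)[OF wo bd] ofilter_below[OF of b(1)]
      unfolding z_def by blast
    have "z \<in> F n" if n: "n \<in> N" for n
    proof -
      have "\<exists>e\<in>F n. y \<prec>\<^bsub>r\<^esub> e \<and> e \<prec>\<^bsub>r\<^esub> z" if y: "y \<prec>\<^bsub>r\<^esub> z" for y
      proof -
        obtain k where k: "\<not> s k \<prec>\<^bsub>r\<^esub> y"
          using y below_ssupD[OF wo] unfolding z_def by blast
        obtain e where e: "e \<in> F n" "s k \<prec>\<^bsub>r\<^esub> e" "e \<prec>\<^bsub>r\<^esub> s (Suc k)"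
          using nx[OF sA, of k] n unfolding s_Suc by blast
        have "y \<prec>\<^bsub>r\<^esub> e"
          using below_trans2[OF wo k e(2)] below_Field(1)[OF y] by blast
        then show ?thesis
          using e below_trans[OF wo e(3) sz] by blast
      qed
      then show ?thesis
        using F[OF n] zA unfolding club_def by blast
    qed
    then show ?thesis
      using zA sz[of 0] by (auto simp: s_def)
  qed
  have cl: "x \<in> A \<inter> (\<Inter>n\<in>N. F n)" if x: "x \<in> A"
    "\<forall>y. y \<prec>\<^bsub>r\<^esub> x \<longrightarrow> (\<exists>e\<in>A \<inter> (\<Inter>n\<in>N. F n). y \<prec>\<^bsub>r\<^esub> e \<and> e \<prec>\<^bsub>r\<^esub> x)" for x
  proof -
    have "x \<in> F n" if n: "n \<in> N" for n
      using F[OF n] x n unfolding club_def by blast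
    then show ?thesis using x(1) by blast
  qed
  show ?thesis
    unfolding club_def using unb cl by blast
qed

lemma club_Int:
  assumes "Well_order r" "ofilter r A"
    and "\<And>X. X \<subseteq> A \<Longrightarrow> |X| \<le>o natLeq \<Longrightarrow> bdd r A X"
    and "club r A E" "club r A E'"
  shows "club r A (E \<inter> E')"
proof -
  have "|{True, False}| \<le>o natLeq"
    by (rule ordLess_imp_ordLeq) (simp add: finite_iff_ordLess_natLeq[symmetric])
  from club_Inter[OF assms(1-3) ordLeq_reflexive[OF natLeq_Well_order] this,
      of "\<lambda>n. if n then E else E'"]
  have "club r A (A \<inter> (\<Inter>n\<in>{True, False}. if n then E else E'))"
    using assms(4,5) by simp
  moreover have "A \<inter> (\<Inter>n\<in>{True, False}. if n then E else E') = E \<inter> E'"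
    using assms(4) unfolding club_def by auto
  ultimately show ?thesis by simp
qed

section \<open>Increasing sequences of regular length\<close>

text \<open>
  An increasing sequence \<open>t\<close> need not be continuous; its suprema \<open>stage j\<close> of initial parts are.  They
  form a club below the limit of the sequence, and clubs of the limit pull back along \<open>stage\<close> to
  clubs of the length \<open>\<mu>\<close>.
\<close>

locale ladder =
  fixes r :: "'a rel" and \<mu> :: "'m rel" and t :: "'m \<Rightarrow> 'a"
  assumes wo: "Well_order r" and \<mu>: "Cinfinite \<mu>" "regularCard \<mu>"
    and bounded: "bdd r (Field r) (t ` Field \<mu>)"
    and increasing: "i \<prec>\<^bsub>\<mu>\<^esub> j \<Longrightarrow> t i \<prec>\<^bsub>r\<^esub> t j"
begin

definition limit :: 'a where "limit = ssup r (t ` Field \<mu>)"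
definition stage :: "'m \<Rightarrow> 'a" where "stage j = ssup r (t ` underS \<mu> j)"

lemma wo\<mu>: "Well_order \<mu>"
  using \<mu>(1) by (auto simp: card_order_on_def)

lemma bdd_sub: "X \<subseteq> Field \<mu> \<Longrightarrow> bdd r (Field r) (t ` X)"
  using bounded unfolding bdd_def by blast

lemma bdd_underS: "bdd r (Field r) (t ` underS \<mu> j)"
  by (rule bdd_sub) (auto dest: below_Field)

lemma t_below_limit: "j \<in> Field \<mu> \<Longrightarrow> t j \<prec>\<^bsub>r\<^esub> limit"
  unfolding limit_def using ssup_upper(1)[OF wo bounded] by blast

lemma limit_Field: "limit \<in> Field r"
  unfolding limit_def using ssup_upper(2)[OF wo bounded] .

lemma stage_Field: "stage j \<in> Field r"
  unfolding stage_def using ssup_upper(2)[OF wo bdd_underS] .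

lemma t_below_stage: "i \<prec>\<^bsub>\<mu>\<^esub> j \<Longrightarrow> t i \<prec>\<^bsub>r\<^esub> stage j"
  unfolding stage_def using ssup_upper(1)[OF wo bdd_underS] by blast

lemma stage_le_t: "j \<in> Field \<mu> \<Longrightarrow> \<not> t j \<prec>\<^bsub>r\<^esub> stage j"
  unfolding stage_def by (rule ssup_least[OF wo]) (use increasing t_below_limit below_Field(1)[OF t_below_limit] in auto)

lemma stage_mono:
  assumes "i \<prec>\<^bsub>\<mu>\<^esub> j" shows "stage i \<prec>\<^bsub>r\<^esub> stage j"
  using below_trans2[OF wo stage_le_t t_below_stage stage_Field] assms below_Field(1) by metis

lemma stage_less_iff:
  assumes "i \<in> Field \<mu>" "j \<in> Field \<mu>"
  shows "stage i \<prec>\<^bsub>r\<^esub> stage j \<longleftrightarrow> i \<prec>\<^bsub>\<mu>\<^esub> j"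
  using below_linear[OF wo\<mu> assms] stage_mono below_irrefl below_trans[OF wo] by metis

lemma stage_below_limit: "j \<in> Field \<mu> \<Longrightarrow> stage j \<prec>\<^bsub>r\<^esub> limit"
  using below_trans2[OF wo stage_le_t t_below_limit stage_Field] by metis

lemma below_limitD:
  assumes "x \<prec>\<^bsub>r\<^esub> limit"
  obtains j where "j \<in> Field \<mu>" "\<not> t j \<prec>\<^bsub>r\<^esub> x"
  using below_ssupD[OF wo assms[unfolded limit_def]] by blast

lemma directed:
  assumes X: "X \<subseteq> underS r limit" "|X| <o \<mu>"
  shows "bdd r (underS r limit) X"
proof -
  have "\<forall>x\<in>X. \<exists>j. j \<in> Field \<mu> \<and> \<not> t j \<prec>\<^bsub>r\<^esub> x"
    using X(1) below_limitD by blast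
  then obtain j where j: "\<And>x. x \<in> X \<Longrightarrow> j x \<in> Field \<mu> \<and> \<not> t (j x) \<prec>\<^bsub>r\<^esub> x"
    by metis
  have "|j ` X| <o \<mu>"
    using X(2) card_of_image ordLeq_ordLess_trans by blast
  then obtain b where b: "b \<in> Field \<mu>" "\<forall>x\<in>X. j x \<prec>\<^bsub>\<mu>\<^esub> b"
    using bdd_regular[OF \<mu>, of "j ` X"] j unfolding bdd_def by blast
  have "x \<prec>\<^bsub>r\<^esub> t b" if "x \<in> X" for x
  proof (rule below_trans2[OF wo])
    show "\<not> t (j x) \<prec>\<^bsub>r\<^esub> x" "t (j x) \<prec>\<^bsub>r\<^esub> t b"
      using j[OF that] increasing b(2) that by blast+
    show "x \<in> Field r"
      using that X(1) below_Field(1)[of x r limit] by blast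
  qed
  then show ?thesis
    unfolding bdd_def using t_below_limit[OF b(1)] by blast
qed

text \<open>
  A point \<open>x\<close> below the limit determines the least \<open>j\<close> with \<open>x \<le> t j\<close>, and then \<open>stage j \<le> x\<close>.  If this
  were strict, a limit point \<open>x\<close> of stages would lie above some later stage and hence above \<open>t j\<close>.
\<close>

lemma club_range: "club r (underS r limit) (stage ` Field \<mu>)"
proof -
  have 1: "\<exists>e\<in>stage ` Field \<mu>. x \<prec>\<^bsub>r\<^esub> e" if x: "x \<prec>\<^bsub>r\<^esub> limit" for x
  proof -
    obtain j where j: "j \<in> Field \<mu>" "\<not> t j \<prec>\<^bsub>r\<^esub> x"
      using below_limitD[OF x] by blast
    obtain k where k: "j \<prec>\<^bsub>\<mu>\<^esub> k"
      using no_max[OF \<mu>(1) j(1)] by blast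
    show ?thesis
      using below_trans2[OF wo j(2) t_below_stage[OF k]] below_Field(1)[OF x] below_Field(2)[OF k] by blast
  qed
  have 2: "x \<in> stage ` Field \<mu>" if x: "x \<prec>\<^bsub>r\<^esub> limit"
    and lim: "\<forall>y. y \<prec>\<^bsub>r\<^esub> x \<longrightarrow> (\<exists>e\<in>stage ` Field \<mu>. y \<prec>\<^bsub>r\<^esub> e \<and> e \<prec>\<^bsub>r\<^esub> x)" for x
  proof -
    let ?J = "{j \<in> Field \<mu>. \<not> t j \<prec>\<^bsub>r\<^esub> x}"
    have "?J \<noteq> {}"
      using below_limitD[OF x] by blast
    then obtain j where j: "j \<in> ?J" "\<And>i. i \<prec>\<^bsub>\<mu>\<^esub> j \<Longrightarrow> i \<notin> ?J"
      using wfE_min'[OF wf_below[OF wo\<mu>], of ?J] by auto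
    have low: "t i \<prec>\<^bsub>r\<^esub> x" if "i \<prec>\<^bsub>\<mu>\<^esub> j" for i
      using j(2)[OF that] below_Field(1)[OF that] by blast
    have a: "\<not> x \<prec>\<^bsub>r\<^esub> stage j"
      unfolding stage_def by (rule ssup_least[OF wo below_Field(1)[OF x]]) (use low in blast)
    have "\<not> stage j \<prec>\<^bsub>r\<^esub> x"
    proof
      assume "stage j \<prec>\<^bsub>r\<^esub> x"
      then obtain k where k: "k \<in> Field \<mu>" "stage j \<prec>\<^bsub>r\<^esub> stage k" "stage k \<prec>\<^bsub>r\<^esub> x"
        using lim by blast
      have "j \<prec>\<^bsub>\<mu>\<^esub> k"
        using stage_less_iff[of j k] k j(1) by blast
      then have "t j \<prec>\<^bsub>r\<^esub> x"
        using below_trans[OF wo t_below_stage k(3)] by blast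
      then show False using j(1) by blast
    qed
    then have "x = stage j"
      using below_linear[OF wo below_Field(1)[OF x] stage_Field[of j]] a by blast
    then show ?thesis using j(1) by blast
  qed
  show ?thesis
    unfolding club_def using stage_below_limit 1 2 by blast
qed

text \<open>
  Uncountable cofinality makes \<open>E\<close> meet the club of all stages in a club.
\<close>

lemma club_pullback:
  assumes unc: "natLeq <o \<mu>" and E: "club r (underS r limit) E"
  shows "club \<mu> (Field \<mu>) {j \<in> Field \<mu>. stage j \<in> E}"
proof -
  have c: "club r (underS r limit) (E \<inter> stage ` Field \<mu>)"
    by (rule club_Int[OF wo ofilter_underS[OF wo] directed E club_range])
      (use unc ordLeq_ordLess_trans in blast)+
  have 1: "\<exists>k\<in>{j \<in> Field \<mu>. stage j \<in> E}. j \<prec>\<^bsub>\<mu>\<^esub> k" if j: "j \<in> Field \<mu>" for j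
  proof -
    obtain e where "e \<in> E \<inter> stage ` Field \<mu>" "stage j \<prec>\<^bsub>r\<^esub> e"
      using c stage_below_limit[OF j] unfolding club_def by blast
    then show ?thesis using stage_less_iff[OF j] by blast
  qed
  have 2: "stage j \<in> E" if j: "j \<in> Field \<mu>"
    and lim: "\<forall>y. y \<prec>\<^bsub>\<mu>\<^esub> j \<longrightarrow> (\<exists>k\<in>{j \<in> Field \<mu>. stage j \<in> E}. y \<prec>\<^bsub>\<mu>\<^esub> k \<and> k \<prec>\<^bsub>\<mu>\<^esub> j)" for j
  proof -
    have "\<exists>e\<in>E. y \<prec>\<^bsub>r\<^esub> e \<and> e \<prec>\<^bsub>r\<^esub> stage j" if y: "y \<prec>\<^bsub>r\<^esub> stage j" for y
    proof -
      obtain i where i: "i \<prec>\<^bsub>\<mu>\<^esub> j" "\<not> t i \<prec>\<^bsub>r\<^esub> y"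
        using below_ssupD[OF wo y[unfolded stage_def]] by blast
      obtain k where k: "stage k \<in> E" "i \<prec>\<^bsub>\<mu>\<^esub> k" "k \<prec>\<^bsub>\<mu>\<^esub> j"
        using lim i(1) by blast
      show ?thesis
        using k below_trans2[OF wo i(2) t_below_stage[OF k(2)] below_Field(1)[OF y]] stage_mono[OF k(3)] by blast
    qed
    then show ?thesis
      using E stage_below_limit[OF j] unfolding club_def by blast
  qed
  show ?thesis
    unfolding club_def using 1 2 by blast
qed

end

section \<open>Club guessing\<close>

lemma card_image_ordLeq: "|X| \<le>o r \<Longrightarrow> |f ` X| \<le>o r"
  by (rule ordLeq_transitive[OF card_of_image])

lemma Well_order_Cinfinite: "Cinfinite r \<Longrightarrow> Well_order r"
  by (auto simp: card_order_on_def)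

lemma uncountable_cardSuc:
  assumes "Cinfinite r"
  shows "natLeq <o cardSuc r"
  using ordLeq_ordLess_trans[OF natLeq_ordLeq_cinfinite[OF assms] cardSuc_greater] assms by blast

lemma less_cardSuc_iff: "Cinfinite r \<Longrightarrow> |X| <o cardSuc r \<longleftrightarrow> |X| \<le>o r"
  using cardSuc_ordLeq_ordLess[of r "|X|"] card_of_Card_order by blast

lemma bdd_cardSuc:
  assumes "Cinfinite r" "X \<subseteq> Field (cardSuc r)" "|X| \<le>o r"
  shows "bdd (cardSuc r) (Field (cardSuc r)) X"
  using bdd_regular[OF Cinfinite_cardSuc regularCard_cardSuc] assms less_cardSuc_iff by blast

lemma card_Field_ordLeq: "Cinfinite r \<Longrightarrow> r \<le>o r' \<Longrightarrow> |Field r| \<le>o r'"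
  using card_of_Field_ordIso ordIso_ordLeq_trans by blast

lemma card_underS_cardSuc:
  assumes "Cinfinite r"
  shows "|underS (cardSuc r) a| \<le>o r"
proof (cases "a \<in> Field (cardSuc r)")
  case True
  then show ?thesis
    using card_of_underS[of "cardSuc r" a] Cinfinite_cardSuc[OF assms] less_cardSuc_iff[OF assms]
    by blast
next
  case False
  then have "underS (cardSuc r) a = {}"
    using below_Field(2) by fast
  then show ?thesis
    using assms card_of_empty1[of r] by (simp add: card_order_on_def)
qed

text \<open>
  Shelah's club guessing for \<open>\<mu> = \<theta>\<^sup>+\<^sup>+\<close>.  Choose for each \<open>i < \<mu>\<close> a club \<open>C i\<close> of \<open>i\<close> of size at most \<open>\<theta>\<close>,
  if there is one.  Every club \<open>E\<close> of \<open>\<mu>\<close> meets some \<open>C i\<close> in \<open>\<theta>\<close> points: take \<open>i\<close> to be the supremum of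
  an increasing \<open>\<theta>\<close>-sequence in \<open>E\<close>.

  For a suitable club \<open>G\<close> the sets \<open>C i \<inter> G\<close> then guess clubs.  Otherwise every club \<open>G\<close> has
  a club \<open>nx G\<close> that includes none of the large sets \<open>C i \<inter> G\<close>, and iterating this \<open>\<theta>\<^sup>+\<close> times, with intersections,
  gives a decreasing sequence of clubs.  Some \<open>C i\<close> meets the intersection of all of them in \<open>\<theta>\<close> points,
  so \<open>C i\<close> loses a point at each of the \<open>\<theta>\<^sup>+\<close> steps, although it has only \<open>\<theta>\<close> points.
\<close>

lemma club_guessing:
  fixes \<theta> :: "'a rel"
  assumes \<theta>: "Cinfinite \<theta>" "regularCard \<theta>" "natLeq <o \<theta>"
  defines "\<mu> \<equiv> cardSuc (cardSuc \<theta>)"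
  shows "\<exists>C. \<forall>E. club \<mu> (Field \<mu>) E \<longrightarrow> (\<exists>i\<in>Field \<mu>. C i \<subseteq> E \<and> \<theta> \<le>o |C i| )"
proof -
  have inf': "Cinfinite (cardSuc \<theta>)"
    using Cinfinite_cardSuc[OF \<theta>(1)] .
  have inf: "Cinfinite \<mu>" and reg: "regularCard \<mu>"
    using Cinfinite_cardSuc[OF inf'] regularCard_cardSuc[OF inf'] by (simp_all add: \<mu>_def)
  note wo = Well_order_Cinfinite[OF inf]
  note wo\<theta> = Well_order_Cinfinite[OF \<theta>(1)]
  have \<theta>_le: "\<theta> \<le>o cardSuc \<theta>"
    using cardSuc_ordLeq[of \<theta>] \<theta>(1) by blast
  have dir: "bdd \<mu> (Field \<mu>) X" if "X \<subseteq> Field \<mu>" "|X| \<le>o cardSuc \<theta>" for X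
    using bdd_cardSuc[OF inf', of X] that unfolding \<mu>_def by blast
  define good where "good i c \<longleftrightarrow> club \<mu> (underS \<mu> i) c \<and> |c| \<le>o \<theta>" for i c
  define C where "C i = (if \<exists>c. good i c then SOME c. good i c else {})" for i
  have C_good: "good i (C i)" if "good i c" for i c
    using that someI_ex[of "good i"] unfolding C_def by auto
  have C_small: "|C i| \<le>o \<theta>" for i
  proof (cases "\<exists>c. good i c")
    case True
    then show ?thesis
      using C_good unfolding good_def by blast
  next
    case False
    then show ?thesis
      using card_of_empty1[of \<theta>] wo\<theta> by (simp add: C_def)
  qed
  \<comment> \<open>\<open>C i\<close> and \<open>E \<inter> i\<close> are clubs of the supremum \<open>i\<close>, and clubs of a point of cofinality \<open>\<theta>\<close> have \<open>\<theta>\<close> points.\<close>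
  have hit: "\<exists>i\<in>Field \<mu>. \<theta> \<le>o |C i \<inter> E|" if E: "club \<mu> (Field \<mu>) E" for E
  proof -
    have EF: "E \<subseteq> Field \<mu>"
      using E unfolding club_def by blast
    have "\<exists>t. \<forall>\<xi>. t \<xi> \<in> E \<and> (\<forall>\<eta>. \<eta> \<prec>\<^bsub>\<theta>\<^esub> \<xi> \<longrightarrow> t \<eta> \<prec>\<^bsub>\<mu>\<^esub> t \<xi>)"
    proof (rule dependent_wf_choice[OF wf_below[OF wo\<theta>],
          where P = "\<lambda>t \<xi> e. e \<in> E \<and> (\<forall>\<eta>. \<eta> \<prec>\<^bsub>\<theta>\<^esub> \<xi> \<longrightarrow> t \<eta> \<prec>\<^bsub>\<mu>\<^esub> e)"])
      fix \<xi> t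
      assume t: "\<And>\<eta>. (\<eta>, \<xi>) \<in> {(x, y). x \<prec>\<^bsub>\<theta>\<^esub> y} \<Longrightarrow> t \<eta> \<in> E \<and> (\<forall>\<zeta>. \<zeta> \<prec>\<^bsub>\<theta>\<^esub> \<eta> \<longrightarrow> t \<zeta> \<prec>\<^bsub>\<mu>\<^esub> t \<eta>)"
      have "|t ` underS \<theta> \<xi>| \<le>o cardSuc \<theta>"
      proof -
        have "|underS \<theta> \<xi>| \<le>o |Field \<theta>|"
          by (rule card_of_mono1) (auto dest: below_Field)
        then show ?thesis
          by (rule card_image_ordLeq[OF ordLeq_transitive[OF _ card_Field_ordLeq[OF \<theta>(1) \<theta>_le]]])
      qed
      moreover have "t ` underS \<theta> \<xi> \<subseteq> Field \<mu>"
        using t EF by blast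
      ultimately obtain b where b: "b \<in> Field \<mu>" "\<forall>x\<in>t ` underS \<theta> \<xi>. x \<prec>\<^bsub>\<mu>\<^esub> b"
        using dir unfolding bdd_def by meson
      obtain e where "e \<in> E" "b \<prec>\<^bsub>\<mu>\<^esub> e"
        using E b(1) unfolding club_def by blast
      then show "\<exists>e. e \<in> E \<and> (\<forall>\<eta>. \<eta> \<prec>\<^bsub>\<theta>\<^esub> \<xi> \<longrightarrow> t \<eta> \<prec>\<^bsub>\<mu>\<^esub> e)"
        using b(2) below_trans[OF wo] by blast
    qed simp
    then obtain t where t: "\<And>\<xi>. t \<xi> \<in> E" "\<And>\<eta> \<xi>. \<eta> \<prec>\<^bsub>\<theta>\<^esub> \<xi> \<Longrightarrow> t \<eta> \<prec>\<^bsub>\<mu>\<^esub> t \<xi>"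
      by blast
    have "|t ` Field \<theta>| \<le>o cardSuc \<theta>"
      by (rule card_image_ordLeq[OF card_Field_ordLeq[OF \<theta>(1) \<theta>_le]])
    then have bd: "bdd \<mu> (Field \<mu>) (t ` Field \<theta>)"
      by (intro dir) (use t(1) EF in auto)
    interpret ladder \<mu> \<theta> t
      by unfold_locales (use wo \<theta> bd t(2) in blast)+
    let ?i = limit
    have small: "bdd \<mu> (underS \<mu> ?i) X" if "X \<subseteq> underS \<mu> ?i" "|X| \<le>o natLeq" for X
      using directed[OF that(1) ordLeq_ordLess_trans[OF that(2) \<theta>(3)]] .
    have "|stage ` Field \<theta>| \<le>o \<theta>"
      by (rule card_image_ordLeq[OF card_Field_ordLeq[OF \<theta>(1) ordLeq_reflexive[OF wo\<theta>]]])
    then have "good ?i (C ?i)"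
      using C_good club_range unfolding good_def by blast
    then have cC: "club \<mu> (underS \<mu> ?i) (C ?i)"
      unfolding good_def by blast
    have cE: "club \<mu> (underS \<mu> ?i) (E \<inter> underS \<mu> ?i)"
    proof -
      have "\<exists>e\<in>E \<inter> underS \<mu> ?i. x \<prec>\<^bsub>\<mu>\<^esub> e" if x: "x \<prec>\<^bsub>\<mu>\<^esub> ?i" for x
      proof -
        have "bdd \<mu> (underS \<mu> ?i) {x}"
          by (rule small) (use x ordLess_imp_ordLeq[of "|{x}|" natLeq] finite_iff_ordLess_natLeq[of "{x}"] in auto)
        then obtain y where y: "y \<prec>\<^bsub>\<mu>\<^esub> ?i" "x \<prec>\<^bsub>\<mu>\<^esub> y"
          unfolding bdd_def by blast
        obtain j where j: "j \<in> Field \<theta>" "\<not> t j \<prec>\<^bsub>\<mu>\<^esub> y"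
          using below_limitD[OF y(1)] by blast
        have "y = t j \<or> y \<prec>\<^bsub>\<mu>\<^esub> t j"
          using below_linear[OF wo] j(2) t(1)[of j] EF below_Field(1)[OF y(1)] by blast
        then have "x \<prec>\<^bsub>\<mu>\<^esub> t j"
          using below_trans[OF wo y(2)] y(2) by blast
        then show ?thesis
          using t(1) t_below_limit[OF j(1)] by blast
      qed
      moreover have "x \<in> E" if "x \<prec>\<^bsub>\<mu>\<^esub> ?i"
        "\<forall>y. y \<prec>\<^bsub>\<mu>\<^esub> x \<longrightarrow> (\<exists>e\<in>E \<inter> underS \<mu> ?i. y \<prec>\<^bsub>\<mu>\<^esub> e \<and> e \<prec>\<^bsub>\<mu>\<^esub> x)" for x
        using E that below_Field(1)[OF that(1)] unfolding club_def by blast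
      ultimately show ?thesis
        unfolding club_def by blast
    qed
    have c: "club \<mu> (underS \<mu> ?i) (C ?i \<inter> (E \<inter> underS \<mu> ?i))"
      using club_Int[OF wo ofilter_underS[OF wo] small cC cE] by blast
    have "\<not> |C ?i \<inter> E| <o \<theta>"
    proof
      assume "|C ?i \<inter> E| <o \<theta>"
      moreover have "C ?i \<inter> (E \<inter> underS \<mu> ?i) = C ?i \<inter> E"
        using cC unfolding club_def by blast
      ultimately obtain b where "b \<prec>\<^bsub>\<mu>\<^esub> ?i" "\<forall>x\<in>C ?i \<inter> (E \<inter> underS \<mu> ?i). x \<prec>\<^bsub>\<mu>\<^esub> b"
        using directed[of "C ?i \<inter> (E \<inter> underS \<mu> ?i)"] unfolding bdd_def by auto
      then show False
        using c below_trans[OF wo] below_irrefl unfolding club_def by meson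
    qed
    then show ?thesis
      using limit_Field not_ordLess_iff_ordLeq[OF wo\<theta> card_of_Well_order] by blast
  qed
  have "\<exists>G. club \<mu> (Field \<mu>) G \<and> (\<forall>E. club \<mu> (Field \<mu>) E \<longrightarrow>
      (\<exists>i\<in>Field \<mu>. C i \<inter> G \<subseteq> E \<and> \<theta> \<le>o |C i \<inter> G| ))"
  proof (rule ccontr)
    assume "\<not> ?thesis"
    then obtain nx where nx: "\<And>G. club \<mu> (Field \<mu>) G \<Longrightarrow> club \<mu> (Field \<mu>) (nx G) \<and>
        (\<forall>i\<in>Field \<mu>. \<theta> \<le>o |C i \<inter> G| \<longrightarrow> \<not> C i \<inter> G \<subseteq> nx G)"
      by metis
    let ?\<sigma> = "cardSuc \<theta>"
    note wo\<sigma> = Well_order_Cinfinite[OF inf']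
    have Inter: "club \<mu> (Field \<mu>) (Field \<mu> \<inter> (\<Inter>\<xi>\<in>N. F \<xi>))"
      if "|N| \<le>o ?\<sigma>" "\<And>\<xi>. \<xi> \<in> N \<Longrightarrow> club \<mu> (Field \<mu>) (F \<xi>)" for N :: "'a set set" and F
      by (rule club_Inter[OF wo ofilter_Field _ natLeq_ordLeq_cinfinite[OF inf'] that]) (rule dir)
    have "\<exists>G. \<forall>\<xi>. club \<mu> (Field \<mu>) (G \<xi>) \<and> (\<forall>\<eta>. \<eta> \<prec>\<^bsub>?\<sigma>\<^esub> \<xi> \<longrightarrow> G \<xi> \<subseteq> nx (G \<eta>))"
    proof (rule dependent_wf_choice[OF wf_below[OF wo\<sigma>],
          where P = "\<lambda>G \<xi> H. club \<mu> (Field \<mu>) H \<and> (\<forall>\<eta>. \<eta> \<prec>\<^bsub>?\<sigma>\<^esub> \<xi> \<longrightarrow> H \<subseteq> nx (G \<eta>))"])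
      fix \<xi> G
      assume G: "\<And>\<eta>. (\<eta>, \<xi>) \<in> {(x, y). x \<prec>\<^bsub>?\<sigma>\<^esub> y} \<Longrightarrow>
          club \<mu> (Field \<mu>) (G \<eta>) \<and> (\<forall>\<zeta>. \<zeta> \<prec>\<^bsub>?\<sigma>\<^esub> \<eta> \<longrightarrow> G \<eta> \<subseteq> nx (G \<zeta>))"
      have "|underS ?\<sigma> \<xi>| \<le>o ?\<sigma>"
        by (rule ordLeq_transitive[OF card_underS_cardSuc[OF \<theta>(1)] \<theta>_le])
      then have "club \<mu> (Field \<mu>) (Field \<mu> \<inter> (\<Inter>\<eta>\<in>underS ?\<sigma> \<xi>. nx (G \<eta>)))"
        by (rule Inter) (use G nx in auto)
      then show "\<exists>H. club \<mu> (Field \<mu>) H \<and> (\<forall>\<eta>. \<eta> \<prec>\<^bsub>?\<sigma>\<^esub> \<xi> \<longrightarrow> H \<subseteq> nx (G \<eta>))"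
        by blast
    qed simp
    then obtain G where G: "\<And>\<xi>. club \<mu> (Field \<mu>) (G \<xi>)"
        "\<And>\<eta> \<xi>. \<eta> \<prec>\<^bsub>?\<sigma>\<^esub> \<xi> \<Longrightarrow> G \<xi> \<subseteq> nx (G \<eta>)"
      by blast
    have "|Field ?\<sigma>| \<le>o ?\<sigma>"
      using card_Field_ordLeq[OF inf' ordLeq_reflexive[OF wo\<sigma>]] .
    then have "club \<mu> (Field \<mu>) (Field \<mu> \<inter> (\<Inter>\<xi>\<in>Field ?\<sigma>. G \<xi>))"
      by (rule Inter) (use G in auto)
    then obtain i where i: "i \<in> Field \<mu>" "\<theta> \<le>o |C i \<inter> (Field \<mu> \<inter> (\<Inter>\<xi>\<in>Field ?\<sigma>. G \<xi>))|"
      using hit by blast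
    have "\<exists>x. x \<in> C i \<inter> G \<xi> \<and> x \<notin> nx (G \<xi>)" if \<xi>: "\<xi> \<in> Field ?\<sigma>" for \<xi>
    proof -
      have "|C i \<inter> (Field \<mu> \<inter> (\<Inter>\<xi>\<in>Field ?\<sigma>. G \<xi>))| \<le>o |C i \<inter> G \<xi>|"
        by (rule card_of_mono1) (use \<xi> in blast)
      then have "\<theta> \<le>o |C i \<inter> G \<xi>|"
        by (rule ordLeq_transitive[OF i(2)])
      then show ?thesis
        using nx[OF G(1), of \<xi>] i(1) by blast
    qed
    then obtain x where x: "\<And>\<xi>. \<xi> \<in> Field ?\<sigma> \<Longrightarrow> x \<xi> \<in> C i \<inter> G \<xi> \<and> x \<xi> \<notin> nx (G \<xi>)"
      by metis
    \<comment> \<open>The point lost at step \<open>\<eta>\<close> is not in \<open>nx (G \<eta>)\<close>, hence in no later \<open>G \<xi>\<close>.\<close>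
    have ne: "x \<eta> \<noteq> x \<xi>" if "\<eta> \<prec>\<^bsub>?\<sigma>\<^esub> \<xi>" for \<eta> \<xi>
      using x[OF below_Field(1)[OF that]] x[OF below_Field(2)[OF that]] G(2)[OF that]
      by (metis IntD2 subsetD)
    have "inj_on x (Field ?\<sigma>)"
      by (rule inj_onI) (metis ne below_linear[OF wo\<sigma>])
    moreover have "x ` Field ?\<sigma> \<subseteq> C i"
      using x by blast
    ultimately have "|Field ?\<sigma>| \<le>o |C i|"
      using card_of_ordLeq by blast
    then have "|Field ?\<sigma>| \<le>o \<theta>"
      by (rule ordLeq_transitive[OF _ C_small])
    then have "?\<sigma> \<le>o \<theta>"
      using ordIso_ordLeq_trans[OF ordIso_symmetric[OF card_of_Field_ordIso[of ?\<sigma>]]] inf' by blast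
    then show False
      using not_ordLess_ordLeq[OF cardSuc_greater[of \<theta>]] \<theta>(1) by blast
  qed
  then obtain G where "\<forall>E. club \<mu> (Field \<mu>) E \<longrightarrow>
      (\<exists>i\<in>Field \<mu>. C i \<inter> G \<subseteq> E \<and> \<theta> \<le>o |C i \<inter> G| )"
    by blast
  then show ?thesis
    by (intro exI[of _ "\<lambda>i. C i \<inter> G"])
qed

section \<open>A sequence that dominates along clubs\<close>

definition eventually_in :: "'l rel \<Rightarrow> ('l \<Rightarrow> bool) \<Rightarrow> bool"
  where "eventually_in l P \<longleftrightarrow> (\<exists>\<nu>\<in>Field l. \<forall>\<beta>. \<nu> \<prec>\<^bsub>l\<^esub> \<beta> \<longrightarrow> P \<beta>)"

text \<open>
  The bound from which on \<open>f a\<close> is larger is the same for all \<open>\<gamma> \<in> S\<close>; this uniformity is the point of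
  the notion.
\<close>

definition dominates ::
    "'l rel \<Rightarrow> ('l \<Rightarrow> 'v rel) \<Rightarrow> ('a \<Rightarrow> 'l \<Rightarrow> 'v) \<Rightarrow> 'a \<Rightarrow> 'a set \<Rightarrow> bool"
  where "dominates l W f a S \<longleftrightarrow>
    eventually_in l (\<lambda>\<beta>. \<forall>\<gamma>\<in>S. f \<gamma> \<beta> \<prec>\<^bsub>W \<beta>\<^esub> f a \<beta>)"

lemma eventually_in_mono:
  "eventually_in l P \<Longrightarrow> (\<And>\<beta>. \<beta> \<in> Field l \<Longrightarrow> P \<beta> \<Longrightarrow> Q \<beta>) \<Longrightarrow> eventually_in l Q"
  unfolding eventually_in_def using below_Field(2) by metis

lemma eventually_in_conj:
  assumes l: "Well_order l" and P: "eventually_in l P" and Q: "eventually_in l Q"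
  shows "eventually_in l (\<lambda>\<beta>. P \<beta> \<and> Q \<beta>)"
proof -
  obtain x where x: "x \<in> Field l" "\<And>\<beta>. x \<prec>\<^bsub>l\<^esub> \<beta> \<Longrightarrow> P \<beta>"
    using P unfolding eventually_in_def by blast
  obtain y where y: "y \<in> Field l" "\<And>\<beta>. y \<prec>\<^bsub>l\<^esub> \<beta> \<Longrightarrow> Q \<beta>"
    using Q unfolding eventually_in_def by blast
  consider "x \<prec>\<^bsub>l\<^esub> y" | "x = y" | "y \<prec>\<^bsub>l\<^esub> x"
    using below_linear[OF l x(1) y(1)] by blast
  then show ?thesis
  proof cases
    case 1
    then show ?thesis
      unfolding eventually_in_def using x y below_trans[OF l 1] by blast
  next
    case 2
    then show ?thesis
      unfolding eventually_in_def using x y by blast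
  next
    case 3
    then show ?thesis
      unfolding eventually_in_def using x y below_trans[OF l 3] by blast
  qed
qed

lemma dominates_subset: "dominates l W f a S \<Longrightarrow> S' \<subseteq> S \<Longrightarrow> dominates l W f a S'"
  unfolding dominates_def by (rule eventually_in_mono) blast+

lemma dominates_trans:
  assumes l: "Well_order l" and W: "\<And>\<beta>. \<beta> \<in> Field l \<Longrightarrow> Well_order (W \<beta>)"
    and "dominates l W f a S" "dominates l W f b {a}"
  shows "dominates l W f b S"
  unfolding dominates_def
  by (rule eventually_in_mono[OF eventually_in_conj[OF l assms(3,4)[unfolded dominates_def]]])
    (use below_trans[OF W] in blast)

lemma Cinfinite_cf:
  assumes "Cinfinite \<kappa>"
  shows "Cinfinite (cf \<kappa>)"
proof -
  obtain K where K: "K \<subseteq> Field \<kappa>" "cofinal K \<kappa>" "cf \<kappa> = |K|"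
    using cf_witness[OF assms] by metis
  have "infinite K"
  proof
    assume "finite K"
    then have "\<exists>b\<in>Field \<kappa>. \<forall>x\<in>K. \<not> b \<prec>\<^bsub>\<kappa>\<^esub> x"
      using K(1)
    proof (induction K)
      case empty
      then show ?case
        using assms infinite_imp_nonempty[of "Field \<kappa>"] unfolding cinfinite_def by auto
    next
      case (insert y K)
      then obtain b where b: "b \<in> Field \<kappa>" "\<And>x. x \<in> K \<Longrightarrow> \<not> b \<prec>\<^bsub>\<kappa>\<^esub> x" "y \<in> Field \<kappa>"
        by blast
      show ?case
      proof (cases "b \<prec>\<^bsub>\<kappa>\<^esub> y")
        case True
        show ?thesis
        proof (intro bexI[OF _ b(3)] ballI notI)
          fix x assume x: "x \<in> insert y K" "y \<prec>\<^bsub>\<kappa>\<^esub> x"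
          then have "x \<in> K"
            using below_irrefl by (metis insertE)
          then show False
            using b(2) below_trans[OF Well_order_Cinfinite[OF assms] True x(2)] by blast
        qed
      qed (use b in blast)
    qed
    then show False
      using K(2) unfolding cofinal_def underS_def by blast
  qed
  then show ?thesis
    unfolding K(3) by (simp add: cinfinite_def Field_card_of card_of_card_order_on)
qed

text \<open>
  A singular cardinal is a limit cardinal, because successor cardinals are regular.
\<close>

lemma cardSuc_less_singular:
  assumes \<kappa>: "Cinfinite \<kappa>" "\<not> regularCard \<kappa>" and \<rho>: "Cinfinite \<rho>" "\<rho> <o \<kappa>"
  shows "cardSuc \<rho> <o \<kappa>"
proof -
  have "cardSuc \<rho> \<le>o \<kappa>"
    using cardSuc_least[of \<rho> \<kappa>] assms by blast
  moreover have "\<not> cardSuc \<rho> =o \<kappa>"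
    using regularCard_ordIso[of "cardSuc \<rho>" \<kappa>] Cinfinite_cardSuc[OF \<rho>(1)]
      regularCard_cardSuc[OF \<rho>(1)] \<kappa>(2) by blast
  ultimately show ?thesis
    using ordLeq_iff_ordLess_or_ordIso by blast
qed

lemma card_insert_underS_less:
  assumes "Cinfinite l" "a \<in> Field l"
  shows "|insert a (underS l a)| <o l"
proof -
  have "|{a}| <o l"
    using ordLess_ordLeq_trans[OF _ natLeq_ordLeq_cinfinite[OF assms(1)], of "|{a}|"]
      finite_iff_ordLess_natLeq[of "{a}"] by simp
  then have "|{a} \<union> underS l a| <o l"
    using card_of_Un_ordLess_infinite_Field[of l "{a}" "underS l a"] card_of_underS[of l a] assms
    unfolding cinfinite_def by blast
  then show ?thesis by simp
qed

text \<open>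
  The witness \<open>B \<xi>\<close> is the union of the segments up to the members of a cofinal set \<open>K\<close> of least size that come no
  later than \<open>\<xi>\<close> in the well-order \<open>cf \<kappa>\<close> of \<open>K\<close>.  These are fewer than \<open>|K|\<close> members, so by minimality
  they are not cofinal and \<open>B \<xi>\<close> is small.  Adding \<open>K\<close> itself makes \<open>B \<xi>\<close> infinite.
\<close>

lemma singular_filtration:
  assumes \<kappa>: "Cinfinite \<kappa>" "\<not> regularCard \<kappa>"
  obtains B where "\<And>\<xi>. \<xi> \<in> Field (cf \<kappa>) \<Longrightarrow> |B \<xi>| <o \<kappa> \<and> infinite (B \<xi>)"
    and "\<And>\<xi> \<eta>. \<xi> \<prec>\<^bsub>cf \<kappa>\<^esub> \<eta> \<Longrightarrow> B \<xi> \<subseteq> B \<eta>"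
    and "\<And>x. x \<in> Field \<kappa> \<Longrightarrow> \<exists>\<xi>\<in>Field (cf \<kappa>). insert x (underS \<kappa> x) \<subseteq> B \<xi>"
proof -
  note wo = Well_order_Cinfinite[OF \<kappa>(1)]
  obtain K where K: "K \<subseteq> Field \<kappa>" "cofinal K \<kappa>" "cf \<kappa> = |K|"
    and min: "\<And>L. L \<subseteq> Field \<kappa> \<Longrightarrow> cofinal L \<kappa> \<Longrightarrow> |K| \<le>o |L|"
    using cf_witness[OF \<kappa>(1)] by metis
  have cfi: "Cinfinite (cf \<kappa>)"
    using Cinfinite_cf[OF \<kappa>(1)] .
  have FK: "Field (cf \<kappa>) = K"
    unfolding K(3) by (simp add: Field_card_of)
  have infK: "infinite K"
    using cfi unfolding cinfinite_def FK by blast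
  have lessK: "|K| <o \<kappa>"
    using not_regularCard_iff_cf[OF \<kappa>(1)] \<kappa>(2) K(3) by simp
  define seg where "seg \<xi> = insert \<xi> (underS (cf \<kappa>) \<xi>)" for \<xi>
  define B where "B \<xi> = K \<union> (\<Union>\<eta>\<in>seg \<xi>. insert \<eta> (underS \<kappa> \<eta>))" for \<xi>
  have "|B \<xi>| <o \<kappa> \<and> infinite (B \<xi>)" if \<xi>: "\<xi> \<in> Field (cf \<kappa>)" for \<xi>
  proof -
    have "|seg \<xi>| <o |K|"
      using card_insert_underS_less[OF cfi \<xi>] unfolding seg_def K(3) .
    moreover have segF: "seg \<xi> \<subseteq> Field \<kappa>"
      using \<xi> below_Field(1) K(1) FK unfolding seg_def by fast
    ultimately have "\<not> cofinal (seg \<xi>) \<kappa>"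
      using min not_ordLess_ordLeq by blast
    then obtain b where b: "b \<in> Field \<kappa>" "\<And>\<eta>. \<eta> \<in> seg \<xi> \<Longrightarrow> \<not> b \<prec>\<^bsub>\<kappa>\<^esub> \<eta>"
      unfolding cofinal_def underS_def by blast
    have "insert \<eta> (underS \<kappa> \<eta>) \<subseteq> insert b (underS \<kappa> b)" if "\<eta> \<in> seg \<xi>" for \<eta>
      using below_linear[OF wo b(1), of \<eta>] b(2)[OF that] segF that below_trans[OF wo] by blast
    then have sub: "B \<xi> \<subseteq> K \<union> insert b (underS \<kappa> b)"
      unfolding B_def by blast
    have "|K \<union> insert b (underS \<kappa> b)| <o \<kappa>"
      using card_of_Un_ordLess_infinite_Field[OF _ _ lessK card_insert_underS_less[OF \<kappa>(1) b(1)]]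
        \<kappa>(1) unfolding cinfinite_def by blast
    then have "|B \<xi>| <o \<kappa>"
      by (rule ordLeq_ordLess_trans[OF card_of_mono1[OF sub]])
    moreover have "infinite (B \<xi>)"
      using infK unfolding B_def by simp
    ultimately show ?thesis by blast
  qed
  moreover have "B \<xi> \<subseteq> B \<eta>" if "\<xi> \<prec>\<^bsub>cf \<kappa>\<^esub> \<eta>" for \<xi> \<eta>
  proof -
    have "seg \<xi> \<subseteq> seg \<eta>"
      using that below_trans[OF Well_order_Cinfinite[OF cfi] _ that] unfolding seg_def by blast
    then show ?thesis
      unfolding B_def by blast
  qed
  moreover have "\<exists>\<xi>\<in>Field (cf \<kappa>). insert x (underS \<kappa> x) \<subseteq> B \<xi>" if x: "x \<in> Field \<kappa>" for x
  proof -
    obtain \<eta> where \<eta>: "\<eta> \<in> K" "x \<prec>\<^bsub>\<kappa>\<^esub> \<eta>"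
      using K(2) x unfolding cofinal_def underS_def by blast
    then have "insert x (underS \<kappa> x) \<subseteq> insert \<eta> (underS \<kappa> \<eta>)"
      using below_trans[OF wo] by blast
    then show ?thesis
      using \<eta>(1) unfolding FK B_def seg_def by blast
  qed
  ultimately show thesis
    using that by blast
qed

lemma ordLess_underS:
  assumes "Well_order \<kappa>" "|E| <o \<kappa>"
  obtains b where "b \<in> Field \<kappa>" "|E| \<le>o |underS \<kappa> b|"
proof -
  obtain b where b: "b \<in> Field \<kappa>" "|E| =o Restr \<kappa> (underS \<kappa> b)"
    using ordLess_iff_ordIso_Restr[OF assms(1) card_of_Well_order] assms(2) by blast
  have "|Field |E| | =o |Field (Restr \<kappa> (underS \<kappa> b))|"
    using card_of_cong[OF b(2)] .
  moreover have "|Field (Restr \<kappa> (underS \<kappa> b))| \<le>o |underS \<kappa> b|"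
    by (rule card_of_mono1) (auto simp: Field_def)
  ultimately have "|E| \<le>o |underS \<kappa> b|"
    using ordIso_ordLeq_trans[of "|E|"] by (simp add: Field_card_of)
  then show thesis
    using that b(1) by blast
qed

text \<open>
  The last clause speaks about those \<open>\<delta>\<close> whose cofinality is below \<open>\<kappa>\<close>, expressed by the existence of
  a small club.  The club that is dominated may differ from the given one, which suffices because
  two clubs of \<open>\<delta>\<close> meet in a club when the cofinality is uncountable.
\<close>

definition club_dominating ::
    "'k rel \<Rightarrow> 'l rel \<Rightarrow> ('l \<Rightarrow> 'v rel) \<Rightarrow> ('k set \<Rightarrow> 'l \<Rightarrow> 'v) \<Rightarrow> bool"
  where "club_dominating \<kappa> l W f \<longleftrightarrow>
    (\<forall>\<beta>\<in>Field l. Well_order (W \<beta>)) \<and>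
    (\<forall>\<alpha> \<gamma>. \<gamma> \<prec>\<^bsub>cardSuc \<kappa>\<^esub> \<alpha> \<longrightarrow> dominates l W f \<alpha> {\<gamma>}) \<and>
    (\<forall>\<delta> E. club (cardSuc \<kappa>) (underS (cardSuc \<kappa>) \<delta>) E \<longrightarrow> |E| <o \<kappa> \<longrightarrow>
      (\<exists>E'. club (cardSuc \<kappa>) (underS (cardSuc \<kappa>) \<delta>) E' \<and> dominates l W f \<delta> E'))"

text \<open>
  At \<open>\<alpha>\<close> and coordinate \<open>\<beta>\<close> the value has to exceed the values of only \<open>|B \<beta>|\<close> many predecessors
  \<open>A \<alpha> \<beta>\<close>, which are bounded in the regular cardinal \<open>W \<beta> = |B \<beta>|\<^sup>+\<close>.  The sets \<open>A \<alpha> \<beta>\<close> increase with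
  \<open>\<beta>\<close>, exhaust all predecessors of \<open>\<alpha>\<close> (through an injection \<open>e \<alpha>\<close> into \<open>\<kappa>\<close> and the filtration \<open>B\<close>), and
  eventually include the whole chosen club \<open>c \<alpha>\<close>, namely once \<open>B \<beta>\<close> is at least as large as it.
\<close>

lemma club_dominating_sequence:
  fixes \<kappa> :: "'k rel"
  assumes \<kappa>: "Cinfinite \<kappa>" "\<not> regularCard \<kappa>"
  obtains W :: "'k \<Rightarrow> 'k set rel" and f :: "'k set \<Rightarrow> 'k \<Rightarrow> 'k set"
  where "club_dominating \<kappa> (cf \<kappa>) W f"
    and "\<And>\<beta>. \<beta> \<in> Field (cf \<kappa>) \<Longrightarrow> |Field (W \<beta>)| \<le>o \<kappa>"
    and "\<And>\<alpha> \<beta>. \<beta> \<in> Field (cf \<kappa>) \<Longrightarrow> f \<alpha> \<beta> \<in> Field (W \<beta>)"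
proof -
  let ?S = "cardSuc \<kappa>"
  note wo = Well_order_Cinfinite[OF \<kappa>(1)]
  note woS = Well_order_Cinfinite[OF Cinfinite_cardSuc[OF \<kappa>(1)]]
  obtain B where B: "\<And>\<xi>. \<xi> \<in> Field (cf \<kappa>) \<Longrightarrow> |B \<xi>| <o \<kappa> \<and> infinite (B \<xi>)"
    and mono: "\<And>\<xi> \<eta>. \<xi> \<prec>\<^bsub>cf \<kappa>\<^esub> \<eta> \<Longrightarrow> B \<xi> \<subseteq> B \<eta>"
    and cover: "\<And>x. x \<in> Field \<kappa> \<Longrightarrow> \<exists>\<xi>\<in>Field (cf \<kappa>). insert x (underS \<kappa> x) \<subseteq> B \<xi>"
    using singular_filtration[OF \<kappa>] by metis
  define W where "W \<beta> = cardSuc |B \<beta>|" for \<beta>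
  have CB: "Cinfinite |B \<beta>|" if "\<beta> \<in> Field (cf \<kappa>)" for \<beta>
    using B[OF that] by (simp add: cinfinite_def Field_card_of card_of_card_order_on)
  have W: "Well_order (W \<beta>) \<and> |Field (W \<beta>)| \<le>o \<kappa>" if \<beta>: "\<beta> \<in> Field (cf \<kappa>)" for \<beta>
  proof -
    have "cardSuc |B \<beta>| \<le>o \<kappa>"
      using cardSuc_least[of "|B \<beta>|" \<kappa>] B[OF \<beta>] \<kappa>(1) card_of_Card_order by blast
    then show ?thesis
      unfolding W_def using Cinfinite_cardSuc[OF CB[OF \<beta>]] Well_order_Cinfinite card_Field_ordLeq
      by blast
  qed
  have "\<exists>e. inj_on e (underS ?S \<alpha>) \<and> e ` underS ?S \<alpha> \<subseteq> Field \<kappa>" for \<alpha>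
  proof -
    have "|underS ?S \<alpha>| \<le>o |Field \<kappa>|"
      using ordLeq_ordIso_trans[OF card_underS_cardSuc[OF \<kappa>(1)]
          ordIso_symmetric[OF card_of_Field_ordIso]] \<kappa>(1) by blast
    then show ?thesis
      using card_of_ordLeq by blast
  qed
  then obtain e where e: "\<And>\<alpha>. inj_on (e \<alpha>) (underS ?S \<alpha>)" "\<And>\<alpha>. e \<alpha> ` underS ?S \<alpha> \<subseteq> Field \<kappa>"
    by metis
  define good where "good \<delta> E \<longleftrightarrow> club ?S (underS ?S \<delta>) E \<and> |E| <o \<kappa>" for \<delta> E
  define c where "c \<delta> = (SOME E. good \<delta> E)" for \<delta>
  define A where "A \<alpha> \<beta> = {\<gamma> \<in> underS ?S \<alpha>. e \<alpha> \<gamma> \<in> B \<beta>} \<union>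
      (if good \<alpha> (c \<alpha>) \<and> |c \<alpha>| \<le>o |B \<beta>| then c \<alpha> else {})" for \<alpha> \<beta>
  have A_below: "A \<alpha> \<beta> \<subseteq> underS ?S \<alpha>" for \<alpha> \<beta>
    unfolding A_def good_def club_def by auto
  have A_small: "|A \<alpha> \<beta>| \<le>o |B \<beta>|" if \<beta>: "\<beta> \<in> Field (cf \<kappa>)" for \<alpha> \<beta>
  proof -
    have "inj_on (e \<alpha>) {\<gamma> \<in> underS ?S \<alpha>. e \<alpha> \<gamma> \<in> B \<beta>}"
      using e(1) by (rule inj_on_subset) blast
    then have "|{\<gamma> \<in> underS ?S \<alpha>. e \<alpha> \<gamma> \<in> B \<beta>}| \<le>o |B \<beta>|"
      using card_of_ordLeq[of "{\<gamma> \<in> underS ?S \<alpha>. e \<alpha> \<gamma> \<in> B \<beta>}" "B \<beta>"] by blast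
    moreover have "|if good \<alpha> (c \<alpha>) \<and> |c \<alpha>| \<le>o |B \<beta>| then c \<alpha> else {}| \<le>o |B \<beta>|"
      by (simp add: card_of_empty)
    ultimately show ?thesis
      unfolding A_def using Un_Cinfinite_bound[OF _ _ CB[OF \<beta>]] by blast
  qed
  have "\<exists>f. \<forall>\<alpha>. \<forall>\<beta>\<in>Field (cf \<kappa>). f \<alpha> \<beta> \<in> Field (W \<beta>) \<and> (\<forall>\<gamma>\<in>A \<alpha> \<beta>. f \<gamma> \<beta> \<prec>\<^bsub>W \<beta>\<^esub> f \<alpha> \<beta>)"
  proof (rule dependent_wf_choice[OF wf_below[OF woS], where
        P = "\<lambda>f \<alpha> g. \<forall>\<beta>\<in>Field (cf \<kappa>). g \<beta> \<in> Field (W \<beta>) \<and> (\<forall>\<gamma>\<in>A \<alpha> \<beta>. f \<gamma> \<beta> \<prec>\<^bsub>W \<beta>\<^esub> g \<beta>)"])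
    fix f f' :: "'k set \<Rightarrow> 'k \<Rightarrow> 'k set" and \<alpha> g
    assume "\<And>\<gamma>. (\<gamma>, \<alpha>) \<in> {(x, y). x \<prec>\<^bsub>?S\<^esub> y} \<Longrightarrow> f \<gamma> = f' \<gamma>"
    then have "f \<gamma> = f' \<gamma>" if "\<gamma> \<in> A \<alpha> \<beta>" for \<gamma> \<beta>
      using A_below that by blast
    then show "(\<forall>\<beta>\<in>Field (cf \<kappa>). g \<beta> \<in> Field (W \<beta>) \<and> (\<forall>\<gamma>\<in>A \<alpha> \<beta>. f \<gamma> \<beta> \<prec>\<^bsub>W \<beta>\<^esub> g \<beta>)) =
        (\<forall>\<beta>\<in>Field (cf \<kappa>). g \<beta> \<in> Field (W \<beta>) \<and> (\<forall>\<gamma>\<in>A \<alpha> \<beta>. f' \<gamma> \<beta> \<prec>\<^bsub>W \<beta>\<^esub> g \<beta>))"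
      by simp
  next
    fix \<alpha> and f :: "'k set \<Rightarrow> 'k \<Rightarrow> 'k set"
    assume f: "\<And>\<gamma>. (\<gamma>, \<alpha>) \<in> {(x, y). x \<prec>\<^bsub>?S\<^esub> y} \<Longrightarrow>
        \<forall>\<beta>\<in>Field (cf \<kappa>). f \<gamma> \<beta> \<in> Field (W \<beta>) \<and> (\<forall>\<zeta>\<in>A \<gamma> \<beta>. f \<zeta> \<beta> \<prec>\<^bsub>W \<beta>\<^esub> f \<gamma> \<beta>)"
    have "\<exists>b\<in>Field (W \<beta>). \<forall>\<gamma>\<in>A \<alpha> \<beta>. f \<gamma> \<beta> \<prec>\<^bsub>W \<beta>\<^esub> b" if \<beta>: "\<beta> \<in> Field (cf \<kappa>)" for \<beta>
    proof -
      have "(\<lambda>\<gamma>. f \<gamma> \<beta>) ` A \<alpha> \<beta> \<subseteq> Field (W \<beta>)"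
        using f A_below[of \<alpha> \<beta>] \<beta> by blast
      then have "bdd (W \<beta>) (Field (W \<beta>)) ((\<lambda>\<gamma>. f \<gamma> \<beta>) ` A \<alpha> \<beta>)"
        unfolding W_def using bdd_cardSuc[OF CB[OF \<beta>] _ card_image_ordLeq[OF A_small[OF \<beta>]]] by blast
      then show ?thesis
        unfolding bdd_def by blast
    qed
    then show "\<exists>g. \<forall>\<beta>\<in>Field (cf \<kappa>). g \<beta> \<in> Field (W \<beta>) \<and> (\<forall>\<gamma>\<in>A \<alpha> \<beta>. f \<gamma> \<beta> \<prec>\<^bsub>W \<beta>\<^esub> g \<beta>)"
      by (intro bchoice) blast
  qed
  then obtain f where f: "\<And>\<alpha> \<beta>. \<beta> \<in> Field (cf \<kappa>) \<Longrightarrow> f \<alpha> \<beta> \<in> Field (W \<beta>)"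
    "\<And>\<alpha> \<beta> \<gamma>. \<beta> \<in> Field (cf \<kappa>) \<Longrightarrow> \<gamma> \<in> A \<alpha> \<beta> \<Longrightarrow> f \<gamma> \<beta> \<prec>\<^bsub>W \<beta>\<^esub> f \<alpha> \<beta>"
    by blast
  have dom: "dominates (cf \<kappa>) W f \<alpha> X"
    if \<xi>: "\<xi> \<in> Field (cf \<kappa>)" and X: "\<And>\<beta>. \<xi> \<prec>\<^bsub>cf \<kappa>\<^esub> \<beta> \<Longrightarrow> X \<subseteq> A \<alpha> \<beta>" for \<alpha> \<xi> X
    unfolding dominates_def eventually_in_def
  proof (intro bexI[OF _ \<xi>] allI impI ballI)
    fix \<beta> \<gamma> assume \<beta>: "\<xi> \<prec>\<^bsub>cf \<kappa>\<^esub> \<beta>" and "\<gamma> \<in> X"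
    then have "\<gamma> \<in> A \<alpha> \<beta>"
      using X by blast
    then show "f \<gamma> \<beta> \<prec>\<^bsub>W \<beta>\<^esub> f \<alpha> \<beta>"
      using f(2) below_Field(2)[OF \<beta>] by blast
  qed
  have "dominates (cf \<kappa>) W f \<alpha> {\<gamma>}" if \<gamma>: "\<gamma> \<prec>\<^bsub>?S\<^esub> \<alpha>" for \<gamma> \<alpha>
  proof -
    have "e \<alpha> \<gamma> \<in> Field \<kappa>"
      using e(2) \<gamma> by blast
    then obtain \<xi> where \<xi>: "\<xi> \<in> Field (cf \<kappa>)" "e \<alpha> \<gamma> \<in> B \<xi>"
      using cover by blast
    show ?thesis
      by (rule dom[OF \<xi>(1)]) (use mono \<xi>(2) \<gamma> in \<open>auto simp: A_def\<close>)
  qed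
  moreover have "\<exists>E'. club ?S (underS ?S \<delta>) E' \<and> dominates (cf \<kappa>) W f \<delta> E'"
    if "club ?S (underS ?S \<delta>) E" "|E| <o \<kappa>" for \<delta> E
  proof -
    have good: "good \<delta> (c \<delta>)"
      using someI[of "good \<delta>" E] that unfolding c_def good_def by blast
    then obtain b where b: "b \<in> Field \<kappa>" "|c \<delta>| \<le>o |underS \<kappa> b|"
      using ordLess_underS[OF wo, of "c \<delta>"] unfolding good_def by blast
    obtain \<xi> where \<xi>: "\<xi> \<in> Field (cf \<kappa>)" "underS \<kappa> b \<subseteq> B \<xi>"
      using cover[OF b(1)] by blast
    have "c \<delta> \<subseteq> A \<delta> \<beta>" if "\<xi> \<prec>\<^bsub>cf \<kappa>\<^esub> \<beta>" for \<beta>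
    proof -
      have "underS \<kappa> b \<subseteq> B \<beta>"
        using mono[OF that] \<xi>(2) by blast
      then have "|c \<delta>| \<le>o |B \<beta>|"
        using ordLeq_transitive[OF b(2) card_of_mono1] by blast
      then show ?thesis
        unfolding A_def using good by auto
    qed
    then show ?thesis
      using dom[OF \<xi>(1), of "c \<delta>" \<delta>] good unfolding good_def by blast
  qed
  ultimately have "club_dominating \<kappa> (cf \<kappa>) W f"
    unfolding club_dominating_def using W by simp
  then show thesis
    using that[of W f] W f(1) by blast
qed

section \<open>Few functions return often to a small set\<close>

text \<open>
  The construction described at the beginning.  Once the guessed \<open>C i\<close> is found, let \<open>n j\<close> be the next
  element of \<open>C i\<close> after \<open>j\<close>.  For \<open>j < k\<close> in \<open>C i\<close>, the value of \<open>f (t j)\<close> is eventually below that of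
  \<open>f (stage (n j))\<close>, with a bound depending on \<open>j\<close> only, and the latter is eventually below that of
  \<open>f (t k)\<close>, with a bound depending on \<open>k\<close> only, because \<open>n j \<le> k\<close> puts \<open>stage (n j)\<close> among
  the indices that \<open>t k\<close> dominates.
\<close>

lemma disjoint_tails:
  fixes \<kappa> :: "'k rel" and W :: "'l \<Rightarrow> 'v rel" and f :: "'k set \<Rightarrow> 'l \<Rightarrow> 'v" and \<theta> :: "'a rel"
  assumes \<kappa>: "Cinfinite \<kappa>" and l: "Well_order l" and dominating: "club_dominating \<kappa> l W f"
    and \<theta>: "Cinfinite \<theta>" "regularCard \<theta>" "natLeq <o \<theta>" "cardSuc (cardSuc \<theta>) <o \<kappa>"
    and T: "T \<subseteq> Field (cardSuc \<kappa>)" "\<forall>x\<in>Field (cardSuc \<kappa>). \<exists>t\<in>T. x \<prec>\<^bsub>cardSuc \<kappa>\<^esub> t"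
  shows "\<exists>(C :: 'a set set set) t \<nu>. \<theta> \<le>o |C| \<and> (\<forall>i\<in>C. t i \<in> T \<and> \<nu> i \<in> Field l) \<and>
    (\<forall>i\<in>C. \<forall>j\<in>C. \<forall>\<beta>. i \<noteq> j \<longrightarrow> \<nu> i \<prec>\<^bsub>l\<^esub> \<beta> \<longrightarrow> \<nu> j \<prec>\<^bsub>l\<^esub> \<beta> \<longrightarrow> f (t i) \<beta> \<noteq> f (t j) \<beta>)"
proof -
  let ?S = "cardSuc \<kappa>"
  note woS = Well_order_Cinfinite[OF Cinfinite_cardSuc[OF \<kappa>]]
  have W: "\<And>\<beta>. \<beta> \<in> Field l \<Longrightarrow> Well_order (W \<beta>)"
    and mono: "\<And>\<gamma> \<alpha>. \<gamma> \<prec>\<^bsub>?S\<^esub> \<alpha> \<Longrightarrow> dominates l W f \<alpha> {\<gamma>}"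
    and clubdom: "\<And>\<delta> E. club ?S (underS ?S \<delta>) E \<Longrightarrow> |E| <o \<kappa> \<Longrightarrow>
        \<exists>E'. club ?S (underS ?S \<delta>) E' \<and> dominates l W f \<delta> E'"
    using dominating unfolding club_dominating_def by simp_all
  define \<mu> where "\<mu> = cardSuc (cardSuc \<theta>)"
  have inf: "Cinfinite \<mu>" and reg: "regularCard \<mu>" and unc: "natLeq <o \<mu>"
    unfolding \<mu>_def using \<theta>(1)
    by (simp_all only: Cinfinite_cardSuc regularCard_cardSuc uncountable_cardSuc)
  note wo\<mu> = Well_order_Cinfinite[OF inf]
  have \<mu>_less: "|Field \<mu>| <o \<kappa>"
    unfolding \<mu>_def by (rule ordLess_Field[OF \<theta>(4)])
  obtain C where C: "\<And>E. club \<mu> (Field \<mu>) E \<Longrightarrow> \<exists>i\<in>Field \<mu>. C i \<subseteq> E \<and> \<theta> \<le>o |C i|"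
    using club_guessing[OF \<theta>(1-3)] unfolding \<mu>_def by blast
  define D where "D i j = C i \<inter> insert j (underS \<mu> j)" for i j
  \<comment> \<open>\<open>R t j\<close> is \<open>stage j\<close>, written as a function of the part of \<open>t\<close> below \<open>j\<close> for the recursion.\<close>
  define R where "R t j = ssup ?S (t ` underS \<mu> j)" for t j
  define P where "P t j r \<longleftrightarrow> r \<in> T \<and> (\<forall>k. k \<prec>\<^bsub>\<mu>\<^esub> j \<longrightarrow> t k \<prec>\<^bsub>?S\<^esub> r) \<and>
      (\<forall>i\<in>Field \<mu>. (\<exists>w\<in>Field ?S. dominates l W f w (R t ` D i j)) \<longrightarrow>
         dominates l W f r (R t ` D i j))" for t j r
  have "\<exists>t. \<forall>j. P t j (t j)"
  proof (rule dependent_wf_choice[OF wf_below[OF wo\<mu>], where P = P])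
    fix t t' :: "'a set set \<Rightarrow> 'k set" and j r
    assume eq: "\<And>k. (k, j) \<in> {(x, y). x \<prec>\<^bsub>\<mu>\<^esub> y} \<Longrightarrow> t k = t' k"
    have "R t k = R t' k" if "k \<in> D i j" for i k
    proof -
      have "t ` underS \<mu> k = t' ` underS \<mu> k"
        by (rule image_cong) (use that eq below_trans[OF wo\<mu>] in \<open>auto simp: D_def\<close>)
      then show ?thesis
        unfolding R_def by simp
    qed
    then have "R t ` D i j = R t' ` D i j" for i
      by (rule image_cong[OF refl])
    then show "P t j r = P t' j r"
      unfolding P_def using eq by simp
  next
    fix j and t :: "'a set set \<Rightarrow> 'k set"
    assume t: "\<And>k. (k, j) \<in> {(x, y). x \<prec>\<^bsub>\<mu>\<^esub> y} \<Longrightarrow> P t k (t k)"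
    have "\<exists>w\<in>Field ?S. (\<exists>w\<in>Field ?S. dominates l W f w (R t ` D i j)) \<longrightarrow>
        dominates l W f w (R t ` D i j)" for i
      using Field_cardSuc_not_empty[of \<kappa>] \<kappa> by blast
    then obtain w where w: "\<And>i. w i \<in> Field ?S" "\<And>i. (\<exists>w\<in>Field ?S. dominates l W f w (R t ` D i j)) \<Longrightarrow>
        dominates l W f (w i) (R t ` D i j)"
      by metis
    \<comment> \<open>Only \<open>\<mu> \<le> \<kappa>\<close> many requirements and earlier entries are to be exceeded, so they are bounded in \<open>\<kappa>\<^sup>+\<close>.\<close>
    have "|underS \<mu> j| \<le>o |Field \<mu>|"
      by (rule card_of_mono1) (auto dest: below_Field)
    then have "|w ` Field \<mu> \<union> t ` underS \<mu> j| \<le>o \<kappa>"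
      using \<kappa> ordLess_imp_ordLeq[OF \<mu>_less]
      by (intro Un_Cinfinite_bound card_image_ordLeq) (simp_all add: ordLeq_transitive)
    moreover have "w ` Field \<mu> \<union> t ` underS \<mu> j \<subseteq> Field ?S"
      using w(1) t T(1) unfolding P_def by blast
    ultimately have "bdd ?S (Field ?S) (w ` Field \<mu> \<union> t ` underS \<mu> j)"
      using bdd_cardSuc[OF \<kappa>] by blast
    then obtain b where b: "b \<in> Field ?S"
        and above: "\<forall>x \<in> w ` Field \<mu> \<union> t ` underS \<mu> j. x \<prec>\<^bsub>?S\<^esub> b"
      unfolding bdd_def by (elim bexE)
    obtain r where r: "r \<in> T" "b \<prec>\<^bsub>?S\<^esub> r"
      using bspec[OF T(2) b] by (elim bexE)
    have "dominates l W f r (R t ` D i j)"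
      if i: "i \<in> Field \<mu>" and "\<exists>w\<in>Field ?S. dominates l W f w (R t ` D i j)" for i
    proof (rule dominates_trans[OF l W w(2)[OF that(2)] mono])
      have "w i \<prec>\<^bsub>?S\<^esub> b"
        using above i by simp
      then show "w i \<prec>\<^bsub>?S\<^esub> r"
        by (rule below_trans[OF woS _ r(2)])
    qed
    moreover have "t k \<prec>\<^bsub>?S\<^esub> r" if "k \<prec>\<^bsub>\<mu>\<^esub> j" for k
    proof -
      have "t k \<prec>\<^bsub>?S\<^esub> b"
        using above that by simp
      then show ?thesis
        by (rule below_trans[OF woS _ r(2)])
    qed
    ultimately show "\<exists>r. P t j r"
      using r(1) unfolding P_def by (intro exI[of _ r]) simp
  qed
  then obtain t where P: "\<And>j. P t j (t j)"
    by blast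
  have t: "t j \<in> T" for j
    using P unfolding P_def by blast
  have t_mono: "t k \<prec>\<^bsub>?S\<^esub> t j" if "k \<prec>\<^bsub>\<mu>\<^esub> j" for j k
    using P[of j] that unfolding P_def by blast
  have t_dom: "dominates l W f (t j) (R t ` D i j)"
    if "i \<in> Field \<mu>" "w \<in> Field ?S" "dominates l W f w (R t ` D i j)" for i j w
    using P[of j] that unfolding P_def by blast
  have "bdd ?S (Field ?S) (t ` Field \<mu>)"
    using bdd_cardSuc[OF \<kappa>, of "t ` Field \<mu>"] t T(1)
      card_image_ordLeq[OF ordLess_imp_ordLeq[OF \<mu>_less]] by blast
  then interpret ladder ?S \<mu> t
    by unfold_locales (use woS inf reg t_mono in blast)+
  have R_eq: "R t = stage"
    by (simp add: fun_eq_iff R_def stage_def)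
  have "|stage ` Field \<mu>| <o \<kappa>"
    by (rule ordLeq_ordLess_trans[OF card_of_image \<mu>_less])
  then obtain E where E: "club ?S (underS ?S limit) E" "dominates l W f limit E"
    using clubdom[OF club_range] by blast
  obtain i where i: "i \<in> Field \<mu>" "C i \<subseteq> {j \<in> Field \<mu>. stage j \<in> E}" "\<theta> \<le>o |C i|"
    using C[OF club_pullback[OF unc E(1)]] by blast
  \<comment> \<open>The limit dominates a superset, so a dominating index existed at stage \<open>j\<close> and \<open>t j\<close> is one.\<close>
  have dom: "dominates l W f (t j) (stage ` D i j)" for j
  proof -
    have "stage ` D i j \<subseteq> E"
      using i(2) unfolding D_def by blast
    then show ?thesis
      using t_dom[OF i(1) limit_Field, of j] dominates_subset[OF E(2)] unfolding R_eq by blast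
  qed
  have "\<exists>n. n \<in> C i \<and> j \<prec>\<^bsub>\<mu>\<^esub> n \<and> (\<forall>k\<in>C i. j \<prec>\<^bsub>\<mu>\<^esub> k \<longrightarrow> \<not> k \<prec>\<^bsub>\<mu>\<^esub> n)"
    if "\<exists>k\<in>C i. j \<prec>\<^bsub>\<mu>\<^esub> k" for j
  proof -
    let ?U = "{k \<in> C i. j \<prec>\<^bsub>\<mu>\<^esub> k}"
    have "?U \<noteq> {}"
      using that by blast
    then obtain m where "m \<in> ?U" "\<And>k. k \<prec>\<^bsub>\<mu>\<^esub> m \<Longrightarrow> k \<notin> ?U"
      using wfE_min'[OF wf_below[OF wo\<mu>], of ?U] by auto
    then show ?thesis by blast
  qed
  then obtain n where n: "\<And>j. \<exists>k\<in>C i. j \<prec>\<^bsub>\<mu>\<^esub> k \<Longrightarrow> n j \<in> C i \<and> j \<prec>\<^bsub>\<mu>\<^esub> n j \<and>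
      (\<forall>k\<in>C i. j \<prec>\<^bsub>\<mu>\<^esub> k \<longrightarrow> \<not> k \<prec>\<^bsub>\<mu>\<^esub> n j)"
    by metis
  \<comment> \<open>The greatest element of \<open>C i\<close>, if any, has no next element; it never plays the part of \<open>j\<close> below.\<close>
  define Q where "Q j \<beta> \<longleftrightarrow> (\<forall>\<gamma>\<in>stage ` D i j. f \<gamma> \<beta> \<prec>\<^bsub>W \<beta>\<^esub> f (t j) \<beta>) \<and>
      ((\<exists>k\<in>C i. j \<prec>\<^bsub>\<mu>\<^esub> k) \<longrightarrow> f (t j) \<beta> \<prec>\<^bsub>W \<beta>\<^esub> f (stage (n j)) \<beta>)" for j \<beta>
  have "eventually_in l (Q j)" for j
  proof (cases "\<exists>k\<in>C i. j \<prec>\<^bsub>\<mu>\<^esub> k")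
    case True
    have "dominates l W f (stage (n j)) {t j}"
      using mono[OF t_below_stage] n[OF True] by blast
    from eventually_in_conj[OF l dom[of j, unfolded dominates_def] this[unfolded dominates_def]]
    show ?thesis
      by (rule eventually_in_mono) (simp add: Q_def)
  next
    case False
    show ?thesis
      by (rule eventually_in_mono[OF dom[of j, unfolded dominates_def]])
        (use False in \<open>simp add: Q_def\<close>)
  qed
  then obtain \<nu> where \<nu>: "\<And>j. \<nu> j \<in> Field l" "\<And>j \<beta>. \<nu> j \<prec>\<^bsub>l\<^esub> \<beta> \<Longrightarrow> Q j \<beta>"
    unfolding eventually_in_def by metis
  have less: "f (t j) \<beta> \<prec>\<^bsub>W \<beta>\<^esub> f (t k) \<beta>"
    if jk: "k \<in> C i" "j \<prec>\<^bsub>\<mu>\<^esub> k" and \<beta>: "\<nu> j \<prec>\<^bsub>l\<^esub> \<beta>" "\<nu> k \<prec>\<^bsub>l\<^esub> \<beta>" for j k \<beta>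
  proof -
    have ex: "\<exists>k\<in>C i. j \<prec>\<^bsub>\<mu>\<^esub> k"
      using jk by blast
    have "n j \<prec>\<^bsub>\<mu>\<^esub> k \<or> n j = k \<or> k \<prec>\<^bsub>\<mu>\<^esub> n j"
      by (rule below_linear[OF wo\<mu> below_Field(2) below_Field(2)]) (use n[OF ex] jk in blast)+
    then have "n j \<in> D i k"
      using n[OF ex] jk unfolding D_def by blast
    then have "f (stage (n j)) \<beta> \<prec>\<^bsub>W \<beta>\<^esub> f (t k) \<beta>"
      using \<nu>(2)[OF \<beta>(2)] unfolding Q_def by blast
    moreover have "f (t j) \<beta> \<prec>\<^bsub>W \<beta>\<^esub> f (stage (n j)) \<beta>"
      using \<nu>(2)[OF \<beta>(1)] ex unfolding Q_def by blast
    ultimately show ?thesis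
      using below_trans[OF W[OF below_Field(2)[OF \<beta>(1)]]] by blast
  qed
  have "f (t j) \<beta> \<noteq> f (t k) \<beta>"
    if jk: "j \<in> C i" "k \<in> C i" "j \<noteq> k" "\<nu> j \<prec>\<^bsub>l\<^esub> \<beta>" "\<nu> k \<prec>\<^bsub>l\<^esub> \<beta>" for j k \<beta>
  proof -
    have "j \<in> Field \<mu>" "k \<in> Field \<mu>"
      using jk(1,2) i(2) by blast+
    then consider "j \<prec>\<^bsub>\<mu>\<^esub> k" | "k \<prec>\<^bsub>\<mu>\<^esub> j"
      using below_linear[OF wo\<mu>] jk(3) by blast
    then show ?thesis
    proof cases
      case 1
      show ?thesis
        using less[OF jk(2) 1 jk(4,5)] below_irrefl by metis
    next
      case 2
      show ?thesis
        using less[OF jk(1) 2 jk(5,4)] below_irrefl by metis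
    qed
  qed
  then show ?thesis
    using i(3) t \<nu>(1) by (intro exI[of _ "C i"] exI[of _ t] exI[of _ \<nu>]) simp
qed

text \<open>
  Since \<open>\<phi>\<close> codes the coordinate along with the value, equal members of \<open>Z\<close> chosen for two indices from
  \<open>disjoint_tails\<close> would be equal values at one coordinate beyond both bounds.  The cardinal \<open>\<theta>\<close> is
  the successor of \<open>|Z \<union> \<lambda>|\<close> rather than of \<open>|Z|\<close> so that it is regular and uncountable even for small \<open>Z\<close>.
\<close>

lemma sparse_functions:
  fixes \<kappa> :: "'k rel"
  assumes \<kappa>: "Cinfinite \<kappa>" "\<not> regularCard \<kappa>"
  obtains \<phi> :: "'k set \<Rightarrow> 'k \<Rightarrow> 'k"
  where "\<And>\<alpha> \<beta>. \<beta> \<in> Field (cf \<kappa>) \<Longrightarrow> \<phi> \<alpha> \<beta> \<in> Field \<kappa>"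
    and "\<And>Z. |Z| <o \<kappa> \<Longrightarrow>
      |{\<alpha> \<in> Field (cardSuc \<kappa>). \<not> |{\<beta> \<in> Field (cf \<kappa>). \<phi> \<alpha> \<beta> \<in> Z}| <o cf \<kappa>}| <o cardSuc \<kappa>"
proof -
  let ?S = "cardSuc \<kappa>" and ?l = "cf \<kappa>"
  have cfi: "Cinfinite ?l"
    using Cinfinite_cf[OF \<kappa>(1)] .
  note l = Well_order_Cinfinite[OF cfi]
  have cf_less: "|Field ?l| <o \<kappa>"
    using ordLess_Field not_regularCard_iff_cf[OF \<kappa>(1)] \<kappa>(2) by blast
  have inf_cf: "infinite (Field ?l)"
    using cfi unfolding cinfinite_def by blast
  have wo\<kappa>: "|Field \<kappa>| =o \<kappa>"
    using card_of_Field_ordIso \<kappa>(1) by blast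
  obtain W :: "'k \<Rightarrow> 'k set rel" and f :: "'k set \<Rightarrow> 'k \<Rightarrow> 'k set"
    where dominating: "club_dominating \<kappa> ?l W f"
    and W: "\<And>\<beta>. \<beta> \<in> Field ?l \<Longrightarrow> |Field (W \<beta>)| \<le>o \<kappa>"
    and f: "\<And>\<alpha> \<beta>. \<beta> \<in> Field ?l \<Longrightarrow> f \<alpha> \<beta> \<in> Field (W \<beta>)"
    using club_dominating_sequence[OF \<kappa>] by blast
  have "|SIGMA \<beta> : Field ?l. Field (W \<beta>)| \<le>o \<kappa>"
    using card_of_Sigma_ordLeq_infinite_Field[of \<kappa> "Field ?l" "\<lambda>\<beta>. Field (W \<beta>)"] \<kappa>(1) W
      ordLess_imp_ordLeq[OF cf_less] unfolding cinfinite_def by blast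
  then have "|SIGMA \<beta> : Field ?l. Field (W \<beta>)| \<le>o |Field \<kappa>|"
    by (rule ordLeq_ordIso_trans[OF _ ordIso_symmetric[OF wo\<kappa>]])
  then obtain J where J: "inj_on J (SIGMA \<beta> : Field ?l. Field (W \<beta>))"
      "J ` (SIGMA \<beta> : Field ?l. Field (W \<beta>)) \<subseteq> Field \<kappa>"
    using card_of_ordLeq[of "SIGMA \<beta> : Field ?l. Field (W \<beta>)" "Field \<kappa>"] by blast
  define \<phi> where "\<phi> \<alpha> \<beta> = J (\<beta>, f \<alpha> \<beta>)" for \<alpha> \<beta>
  have "\<phi> \<alpha> \<beta> \<in> Field \<kappa>" if "\<beta> \<in> Field ?l" for \<alpha> \<beta>
    using J(2) f[OF that] that unfolding \<phi>_def by blast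
  moreover have "|{\<alpha> \<in> Field ?S. \<not> |{\<beta> \<in> Field ?l. \<phi> \<alpha> \<beta> \<in> Z}| <o ?l}| <o ?S"
    if Z: "|Z| <o \<kappa>" for Z
  proof (rule ccontr)
    define T where "T = {\<alpha> \<in> Field ?S. \<not> |{\<beta> \<in> Field ?l. \<phi> \<alpha> \<beta> \<in> Z}| <o ?l}"
    assume "\<not> ?thesis"
    then have big: "\<not> |T| <o ?S"
      unfolding T_def .
    let ?A = "Z \<union> Field ?l"
    have A: "Cinfinite |?A|" "|?A| <o \<kappa>"
      using inf_cf card_of_Un_ordLess_infinite_Field[OF _ _ Z cf_less] \<kappa>(1)
      by (auto simp: cinfinite_def Field_card_of card_of_card_order_on)
    define \<theta> where "\<theta> = cardSuc |?A|"
    have \<theta>: "Cinfinite \<theta>" "regularCard \<theta>" "natLeq <o \<theta>" "cardSuc (cardSuc \<theta>) <o \<kappa>"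
      unfolding \<theta>_def using A
      by (simp_all only: Cinfinite_cardSuc regularCard_cardSuc uncountable_cardSuc
          cardSuc_less_singular[OF \<kappa>])
    have T_sub: "T \<subseteq> Field ?S"
      unfolding T_def by blast
    have unb: "\<forall>x\<in>Field ?S. \<exists>t\<in>T. x \<prec>\<^bsub>?S\<^esub> t"
    proof (rule ballI, rule ccontr)
      fix x assume x: "x \<in> Field ?S" and none: "\<not> (\<exists>t\<in>T. x \<prec>\<^bsub>?S\<^esub> t)"
      have sub: "T \<subseteq> insert x (underS ?S x)"
        using below_linear[OF Well_order_Cinfinite[OF Cinfinite_cardSuc[OF \<kappa>(1)]] x] none
          T_sub by blast
      have "|T| <o ?S"
        by (rule ordLeq_ordLess_trans[OF card_of_mono1[OF sub]
              card_insert_underS_less[OF Cinfinite_cardSuc[OF \<kappa>(1)] x]])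
      then show False
        using big by blast
    qed
    obtain C :: "'k set set set set" and t \<nu>
      where *: "\<theta> \<le>o |C| \<and> (\<forall>i\<in>C. t i \<in> T \<and> \<nu> i \<in> Field ?l) \<and>
        (\<forall>i\<in>C. \<forall>j\<in>C. \<forall>\<beta>. i \<noteq> j \<longrightarrow> \<nu> i \<prec>\<^bsub>?l\<^esub> \<beta> \<longrightarrow> \<nu> j \<prec>\<^bsub>?l\<^esub> \<beta> \<longrightarrow> f (t i) \<beta> \<noteq> f (t j) \<beta>)"
      using disjoint_tails[OF \<kappa>(1) l dominating \<theta> T_sub unb] by (elim exE)
    have C: "\<theta> \<le>o |C|"
      and t: "\<And>i. i \<in> C \<Longrightarrow> t i \<in> T \<and> \<nu> i \<in> Field ?l"
      and ne: "\<And>i j \<beta>. i \<in> C \<Longrightarrow> j \<in> C \<Longrightarrow> i \<noteq> j \<Longrightarrow> \<nu> i \<prec>\<^bsub>?l\<^esub> \<beta> \<Longrightarrow> \<nu> j \<prec>\<^bsub>?l\<^esub> \<beta> \<Longrightarrow>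
           f (t i) \<beta> \<noteq> f (t j) \<beta>"
      using * by blast+
    have "\<exists>\<beta>. \<beta> \<in> Field ?l \<and> \<phi> (t i) \<beta> \<in> Z \<and> \<nu> i \<prec>\<^bsub>?l\<^esub> \<beta>" if i: "i \<in> C" for i
    proof (rule ccontr)
      assume "\<not> ?thesis"
      then have sub: "{\<beta> \<in> Field ?l. \<phi> (t i) \<beta> \<in> Z} \<subseteq> insert (\<nu> i) (underS ?l (\<nu> i))"
        using below_linear[OF l, of "\<nu> i"] t[OF i] by fast
      have "|{\<beta> \<in> Field ?l. \<phi> (t i) \<beta> \<in> Z}| <o ?l"
        by (rule ordLeq_ordLess_trans[OF card_of_mono1[OF sub] card_insert_underS_less[OF cfi]])
          (use t[OF i] in blast)
      then show False
        using t[OF i] unfolding T_def by blast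
    qed
    then obtain b where b: "\<And>i. i \<in> C \<Longrightarrow> b i \<in> Field ?l \<and> \<phi> (t i) (b i) \<in> Z \<and> \<nu> i \<prec>\<^bsub>?l\<^esub> b i"
      by metis
    have "inj_on (\<lambda>i. \<phi> (t i) (b i)) C"
    proof (rule inj_onI, rule ccontr)
      fix i j assume ij: "i \<in> C" "j \<in> C" "\<phi> (t i) (b i) = \<phi> (t j) (b j)" "i \<noteq> j"
      have "(b i, f (t i) (b i)) = (b j, f (t j) (b j))"
        by (rule inj_onD[OF J(1)]) (use ij b f in \<open>auto simp: \<phi>_def\<close>)
      then have eq: "b j = b i" "f (t i) (b i) = f (t j) (b i)"
        by (metis Pair_inject)+
      have "\<nu> i \<prec>\<^bsub>?l\<^esub> b i" "\<nu> j \<prec>\<^bsub>?l\<^esub> b i"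
        using b[OF ij(1)] b[OF ij(2)] unfolding eq(1) by blast+
      then show False
        using ne[OF ij(1,2,4)] eq(2) by blast
    qed
    moreover have "(\<lambda>i. \<phi> (t i) (b i)) ` C \<subseteq> ?A"
      using b by blast
    ultimately have "|C| \<le>o |?A|"
      using card_of_ordLeq by blast
    then have "\<theta> \<le>o |?A|"
      by (rule ordLeq_transitive[OF C])
    then show False
      using not_ordLess_ordLeq[OF cardSuc_greater[of "|?A|"]] A(1) unfolding \<theta>_def by blast
  qed
  ultimately show thesis
    using that[of \<phi>] by blast
qed

theorem corollary3p3:
  fixes \<kappa> :: "'k rel" and I :: "'i set" and I' :: "'j set"
    and D :: "'i set set" and D' :: "'j set set"
  assumes "Cinfinite \<kappa>"
    and "D \<subseteq> Pow I" and "D' \<subseteq> Pow I'"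
    and "\<not> regularCard \<kappa>"
    and "decomposable (cf \<kappa>) I' D'"
    and "decomposable (cardSuc \<kappa>) I D"
  shows "decomposable \<kappa> (I \<times> I') (family_prod I D I' D')"
proof -
  obtain \<phi> :: "'k set \<Rightarrow> 'k \<Rightarrow> 'k"
    where \<phi>: "\<And>\<alpha> \<beta>. \<beta> \<in> Field (cf \<kappa>) \<Longrightarrow> \<phi> \<alpha> \<beta> \<in> Field \<kappa>"
    and sparse: "\<And>Z. |Z| <o \<kappa> \<Longrightarrow>
      |{\<alpha> \<in> Field (cardSuc \<kappa>). \<not> |{\<beta> \<in> Field (cf \<kappa>). \<phi> \<alpha> \<beta> \<in> Z}| <o cf \<kappa>}| <o cardSuc \<kappa>"
    using sparse_functions[OF assms(1,4)] by blast
  obtain g where g_dec: "g ` I' \<subseteq> Field (cf \<kappa>) \<and>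
      (\<forall>Y. Y \<subseteq> Field (cf \<kappa>) \<and> |Y| <o cf \<kappa> \<longrightarrow> g -` Y \<inter> I' \<notin> D')"
    using assms(5) unfolding decomposable_def by (elim exE)
  have g: "g ` I' \<subseteq> Field (cf \<kappa>)"
    "\<And>Y. Y \<subseteq> Field (cf \<kappa>) \<Longrightarrow> |Y| <o cf \<kappa> \<Longrightarrow> g -` Y \<inter> I' \<notin> D'"
    using g_dec by simp_all
  obtain f where f_dec: "f ` I \<subseteq> Field (cardSuc \<kappa>) \<and>
      (\<forall>X. X \<subseteq> Field (cardSuc \<kappa>) \<and> |X| <o cardSuc \<kappa> \<longrightarrow> f -` X \<inter> I \<notin> D)"
    using assms(6) unfolding decomposable_def by (elim exE)
  have f: "f ` I \<subseteq> Field (cardSuc \<kappa>)"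
    "\<And>X. X \<subseteq> Field (cardSuc \<kappa>) \<Longrightarrow> |X| <o cardSuc \<kappa> \<Longrightarrow> f -` X \<inter> I \<notin> D"
    using f_dec by simp_all
  define h where "h = (\<lambda>(i, i'). \<phi> (f i) (g i'))"
  have "h -` Z \<inter> (I \<times> I') \<notin> family_prod I D I' D'" if Z: "|Z| <o \<kappa>" for Z
  proof
    assume h: "h -` Z \<inter> (I \<times> I') \<in> family_prod I D I' D'"
    define Y where "Y \<alpha> = {\<beta> \<in> Field (cf \<kappa>). \<phi> \<alpha> \<beta> \<in> Z}" for \<alpha>
    define X where "X = {\<alpha> \<in> Field (cardSuc \<kappa>). g -` Y \<alpha> \<inter> I' \<in> D'}"
    \<comment> \<open>The sections of \<open>h -` Z\<close> over \<open>I\<close> depend on \<open>f i\<close> only, so the indices of large sections form a preimage under \<open>f\<close>.\<close>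
    have "{i' \<in> I'. (i, i') \<in> h -` Z \<inter> (I \<times> I')} = g -` Y (f i) \<inter> I'" if "i \<in> I" for i
      using that g(1) by (auto simp: h_def Y_def)
    then have "{i \<in> I. {i' \<in> I'. (i, i') \<in> h -` Z \<inter> (I \<times> I')} \<in> D'} = f -` X \<inter> I"
      using f(1) by (auto simp: X_def)
    then have "f -` X \<inter> I \<in> D"
      using h unfolding family_prod_def by simp
    moreover have "|X| <o cardSuc \<kappa>"
    proof (rule ordLeq_ordLess_trans[OF card_of_mono1 sparse[OF Z]])
      have "\<not> |Y \<alpha>| <o cf \<kappa>" if "\<alpha> \<in> X" for \<alpha>
        using g(2)[of "Y \<alpha>"] that by (auto simp: X_def Y_def)
      then show "X \<subseteq> {\<alpha> \<in> Field (cardSuc \<kappa>). \<not> |{\<beta> \<in> Field (cf \<kappa>). \<phi> \<alpha> \<beta> \<in> Z}| <o cf \<kappa>}"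
        unfolding X_def Y_def by blast
    qed
    moreover have "X \<subseteq> Field (cardSuc \<kappa>)"
      unfolding X_def by blast
    ultimately show False
      using f(2) by blast
  qed
  moreover have "h ` (I \<times> I') \<subseteq> Field \<kappa>"
    using \<phi> g(1) by (auto simp: h_def)
  ultimately show ?thesis
    unfolding decomposable_def by blast
qed

end
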